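(* Let $V=\mathbb Z^d$, and let $\{\eta(t),t\ge0\}$ on $\Omega=E^V$ be dual to a discrete particle system $\{\xi(t),t\ge0\}$ on finite configurations $\xi\in\hat\Omega$ (with $\hat E\subset\mathbb N$), with factorized duality function $D(\xi,\eta)=\prod_{x\in V}d(\xi_x,\eta_x)$ satisfying $d(0,\cdot)\equiv1$. Assume that the dual process conserves the number of particles and satisfies bounded harmonic triviality. Let $\mu$ be a probability measure on $\Omega$ such that the uniform domination property of $D$ w.r.t. $\mu$ holds. If $\mu$ is a translation-invariant and ergodic (under translations) stationary measure for $\{\eta(t),t\ge0\}$, then for all finite configurations $\xi\in\hat\Omega$ and all $x\in V$, $$\int D(\xi,\eta)\,\mu(d\eta)=\left(\int D(\delta_x,\eta)\,\mu(d\eta)\right)^{|\xi|};$$ as a consequence, $\mu$ is a product measure.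
   Context: $E$ is one of $\mathbb N=\{0,1,\dots\}$, $\{0,\dots,N\}$, or $\mathbb R_+=[0,\infty)$; $\hat E$ is $\mathbb N$ or $\{0,\dots,N\}$; $\hat\Omega=\hat E^V$. A configuration $\xi\in\hat E^V$ is finite if $|\xi|:=\sum_{x\in V}\xi_x<\infty$; for such $\xi$ the product defining $D(\xi,\eta)$ has only finitely many factors different from $1$. $\delta_x$ is the configuration with a single particle at $x$ and none elsewhere. Duality with (measurable) duality function $D$ means: for all $t>0$, all finite $\xi\in\hat\Omega$ and all $\eta\in\Omega$, $\hat{\mathbb E}_\xi D(\xi(t),\eta)=\mathbb E_\eta D(\xi,\eta(t))$. Bounded harmonic triviality of the dual process: if $H$ is a bounded function on finite configurations with $\hat{\mathbb E}_\xi H(\xi(t))=H(\xi)$ for all $t>0$ and all finite $\xi$, then $H(\xi)=\psi(|\xi|)$ for some bounded function $\psi:\mathbb N\to\mathbb R$. Uniform domination property of $D$ w.r.t. $\mu$: for all $n\in\mathbb N$ there exists a $\mu$-integrable function $f_n$ such that $\sup_{\xi\in\hat\Omega,\,|\xi|=n}|D(\xi,\eta)|\le f_n(\eta)$ for all $\eta\in\Omega$. A product measure is a measure of the form $\otimes_{x\in V}\nu_x$ with $\nu_x$ probability measures on $E$.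
   Formalization: That μ is a product measure is proved only if each one-site marginal of μ is the unique probability measure on E with its integrals of d(k,·), k in Ê; without this it fails, e.g. for d≡1, η(t)=η(0) and any non-product ergodic μ. *)

theory Defs
  imports "HOL-Probability.Probability" "HOL-Library.Groups_Big_Fun"
begin

(* The single-site spaces of the process are taken as subsets of the reals and those of the dual
   as sets of naturals; on \<nat> and {0,...,N} the trace of the Borel sigma-algebra is discrete. *)

definition process_site_space :: "real set \<Rightarrow> bool" where
  "process_site_space E \<longleftrightarrow> E = \<nat> \<or> (\<exists>N::nat. E = real ` {0..N}) \<or> E = {0..}"

definition dual_site_space :: "nat set \<Rightarrow> bool" where
  "dual_site_space K \<longleftrightarrow> K = UNIV \<or> (\<exists>N. K = {0..N})"

definition site_measurable :: "real set \<Rightarrow> real measure" where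
  "site_measurable E = restrict_space borel E"

definition configs :: "real set \<Rightarrow> ('v \<Rightarrow> real) measure" where
  "configs E = PiM UNIV (\<lambda>_. site_measurable E)"

(* Summability is with respect to the discrete topology of nat; see finite_configs_iff below. *)

definition finite_configs :: "nat set \<Rightarrow> ('v \<Rightarrow> nat) set" where
  "finite_configs K = {\<xi>. (\<forall>x. \<xi> x \<in> K) \<and> \<xi> summable_on UNIV}"

definition particles :: "('v \<Rightarrow> nat) \<Rightarrow> nat" where
  "particles \<xi> = (\<Sum>\<^sub>\<infinity>x. \<xi> x)"

definition single :: "'v \<Rightarrow> 'v \<Rightarrow> nat" where
  "single x = (\<lambda>y. if y = x then 1 else 0)"

definition factorized :: "(nat \<Rightarrow> real \<Rightarrow> real) \<Rightarrow> ('v \<Rightarrow> nat) \<Rightarrow> ('v \<Rightarrow> real) \<Rightarrow> real" where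
  "factorized d \<xi> \<eta> = (\<Prod>x. d (\<xi> x) (\<eta> x))"

(* A time-homogeneous Markov process on M is given by its transition kernels: P t x is the law at
   time t of the process started from x, so the expectation of f(X(t)) started from x is the
   integral of f against P t x. *)

definition markov_semigroup :: "'a measure \<Rightarrow> (real \<Rightarrow> 'a \<Rightarrow> 'a measure) \<Rightarrow> bool" where
  "markov_semigroup M P \<longleftrightarrow>
     (\<forall>t\<ge>0. P t \<in> M \<rightarrow>\<^sub>M prob_algebra M) \<and>
     (\<forall>x\<in>space M. P 0 x = return M x) \<and>
     (\<forall>s\<ge>0. \<forall>t\<ge>0. \<forall>x\<in>space M. P (s + t) x = P s x \<bind> P t)"

definition stationary :: "(real \<Rightarrow> 'a \<Rightarrow> 'a measure) \<Rightarrow> 'a measure \<Rightarrow> bool" where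
  "stationary P \<mu> \<longleftrightarrow> (\<forall>t\<ge>0. \<mu> \<bind> P t = \<mu>)"

(* Existence of the two expectations is part of the duality relation: the Bochner integral of a
   non-integrable function is 0 by convention. *)

definition dual_processes ::
  "real set \<Rightarrow> nat set \<Rightarrow> (real \<Rightarrow> ('v \<Rightarrow> real) \<Rightarrow> ('v \<Rightarrow> real) measure) \<Rightarrow>
   (real \<Rightarrow> ('v \<Rightarrow> nat) \<Rightarrow> ('v \<Rightarrow> nat) measure) \<Rightarrow>
   (('v \<Rightarrow> nat) \<Rightarrow> ('v \<Rightarrow> real) \<Rightarrow> real) \<Rightarrow> bool" where
  "dual_processes E K P Q D \<longleftrightarrow>
     (\<forall>\<xi>\<in>finite_configs K. D \<xi> \<in> borel_measurable (configs E)) \<and>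
     (\<forall>t>0. \<forall>\<xi>\<in>finite_configs K. \<forall>\<eta>\<in>space (configs E).
        integrable (Q t \<xi>) (\<lambda>\<xi>'. D \<xi>' \<eta>) \<and> integrable (P t \<eta>) (D \<xi>) \<and>
        (\<integral>\<xi>'. D \<xi>' \<eta> \<partial>Q t \<xi>) = (\<integral>\<eta>'. D \<xi> \<eta>' \<partial>P t \<eta>))"

definition conserves_particles ::
  "nat set \<Rightarrow> (real \<Rightarrow> ('v \<Rightarrow> nat) \<Rightarrow> ('v \<Rightarrow> nat) measure) \<Rightarrow> bool" where
  "conserves_particles K Q \<longleftrightarrow>
     (\<forall>t\<ge>0. \<forall>\<xi>\<in>finite_configs K. AE \<xi>' in Q t \<xi>. particles \<xi>' = particles \<xi>)"

definition bounded_harmonic_triviality ::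
  "nat set \<Rightarrow> (real \<Rightarrow> ('v \<Rightarrow> nat) \<Rightarrow> ('v \<Rightarrow> nat) measure) \<Rightarrow> bool" where
  "bounded_harmonic_triviality K Q \<longleftrightarrow>
     (\<forall>H :: ('v \<Rightarrow> nat) \<Rightarrow> real.
        bounded (H ` finite_configs K) \<and>
        (\<forall>t>0. \<forall>\<xi>\<in>finite_configs K. (\<integral>\<xi>'. H \<xi>' \<partial>Q t \<xi>) = H \<xi>) \<longrightarrow>
        (\<exists>\<psi> :: nat \<Rightarrow> real. bounded (range \<psi>) \<and>
           (\<forall>\<xi>\<in>finite_configs K. H \<xi> = \<psi> (particles \<xi>))))"

definition uniform_domination ::
  "real set \<Rightarrow> nat set \<Rightarrow> (('v \<Rightarrow> nat) \<Rightarrow> ('v \<Rightarrow> real) \<Rightarrow> real) \<Rightarrow> ('v \<Rightarrow> real) measure \<Rightarrow> bool" where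
  "uniform_domination E K D \<mu> \<longleftrightarrow>
     (\<forall>n. \<exists>f :: ('v \<Rightarrow> real) \<Rightarrow> real. integrable \<mu> f \<and>
        (\<forall>\<eta>\<in>space (configs E). \<forall>\<xi>\<in>finite_configs K. particles \<xi> = n \<longrightarrow> \<bar>D \<xi> \<eta>\<bar> \<le> f \<eta>))"

definition shift :: "'v \<Rightarrow> ('v::plus \<Rightarrow> 'b) \<Rightarrow> 'v \<Rightarrow> 'b" where
  "shift z \<eta> = (\<lambda>x. \<eta> (x + z))"

definition translation_invariant :: "('v::plus \<Rightarrow> 'b) measure \<Rightarrow> bool" where
  "translation_invariant \<mu> \<longleftrightarrow> (\<forall>z. distr \<mu> \<mu> (shift z) = \<mu>)"

definition translation_ergodic :: "('v::plus \<Rightarrow> 'b) measure \<Rightarrow> bool" where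
  "translation_ergodic \<mu> \<longleftrightarrow>
     (\<forall>A\<in>sets \<mu>. (\<forall>z. shift z -` A \<inter> space \<mu> = A) \<longrightarrow> measure \<mu> A = 0 \<or> measure \<mu> A = 1)"

definition product_measure :: "real set \<Rightarrow> ('v \<Rightarrow> real) measure \<Rightarrow> bool" where
  "product_measure E \<mu> \<longleftrightarrow>
     (\<exists>\<nu>. (\<forall>x. prob_space (\<nu> x) \<and> sets (\<nu> x) = sets (site_measurable E)) \<and> \<mu> = PiM UNIV \<nu>)"

(* The single-site duality functions d k, k in K, determine the probability measure \<nu> on E.
   Without such a property no information about \<mu> beyond the expectations of products of the
   d k is available: for d constantly 1 those carry no information at all. *)

definition determined_by ::
  "real set \<Rightarrow> nat set \<Rightarrow> (nat \<Rightarrow> real \<Rightarrow> real) \<Rightarrow> real measure \<Rightarrow> bool" where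
  "determined_by E K d \<nu> \<longleftrightarrow>
     (\<forall>\<nu>'. prob_space \<nu>' \<and> sets \<nu>' = sets (site_measurable E) \<and>
        (\<forall>k\<in>K. integrable \<nu>' (d k) \<and> (\<integral>e. d k e \<partial>\<nu>') = (\<integral>e. d k e \<partial>\<nu>)) \<longrightarrow> \<nu>' = \<nu>)"

definition marginal :: "real set \<Rightarrow> ('v \<Rightarrow> real) measure \<Rightarrow> 'v \<Rightarrow> real measure" where
  "marginal E \<mu> x = distr \<mu> (site_measurable E) (\<lambda>\<eta>. \<eta> x)"

lemma nat_has_sum_finite_support:
  fixes f :: "'v \<Rightarrow> nat"
  assumes "(f has_sum s) UNIV"
  shows "finite {x. f x \<noteq> 0}"
proof -
  have "open {s}" by (rule Topological_Spaces.open_discrete)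
  then have "eventually (\<lambda>F. sum f F \<in> {s}) (finite_subsets_at_top UNIV)"
    using assms unfolding has_sum_def by (intro topological_tendstoD) auto
  then obtain X where X: "finite X" "\<And>Y. finite Y \<Longrightarrow> X \<subseteq> Y \<Longrightarrow> sum f Y = s"
    unfolding eventually_finite_subsets_at_top by auto
  have "f x = 0" if "x \<notin> X" for x
    using X(2)[of X] X(2)[of "insert x X"] X(1) that by auto
  then have "{x. f x \<noteq> 0} \<subseteq> X" by (metis (mono_tags, lifting) mem_Collect_eq subsetI)
  then show ?thesis using X(1) finite_subset by blast
qed

lemma finite_configs_iff:
  "\<xi> \<in> finite_configs K \<longleftrightarrow> (\<forall>x. \<xi> x \<in> K) \<and> finite {x. \<xi> x \<noteq> 0}"
proof -
  have "\<xi> summable_on UNIV" if fin: "finite {x. \<xi> x \<noteq> 0}"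
  proof -
    have "(\<xi> has_sum sum \<xi> {x. \<xi> x \<noteq> 0}) {x. \<xi> x \<noteq> 0}"
      using fin by (rule has_sum_finite)
    then have "(\<xi> has_sum sum \<xi> {x. \<xi> x \<noteq> 0}) UNIV"
      by (subst has_sum_cong_neutral[where T = "{x. \<xi> x \<noteq> 0}" and g = \<xi>]) auto
    then show ?thesis by (auto simp: summable_on_def)
  qed
  then show ?thesis
    unfolding finite_configs_def summable_on_def
    using nat_has_sum_finite_support by auto
qed

lemma particles_eq_sum:
  assumes "\<xi> \<in> finite_configs K"
  shows "particles \<xi> = (\<Sum>x | \<xi> x \<noteq> 0. \<xi> x)"
proof -
  have "finite {x. \<xi> x \<noteq> 0}" using assms by (simp add: finite_configs_iff)
  moreover have "infsum \<xi> UNIV = infsum \<xi> {x. \<xi> x \<noteq> 0}"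
    by (rule infsum_cong_neutral) auto
  ultimately show ?thesis by (simp add: particles_def)
qed

end

(* By duality and stationarity, the expectation of D(\<xi>) under \<mu>, restricted to configurations with n
   particles, is a bounded harmonic function of the dual process, hence depends on |\<xi>| only. Adding
   k particles at an empty site x therefore gives an expectation that does not depend on x, and x
   may be averaged over many sites. Domination and ergodicity make the d(k, \<eta>_x) bounded uniformly
   in x, almost surely; as their covariances at distinct sites are all equal, the averages
   converge, and to a constant by ergodicity. So the expectation of D(\<xi>) factorizes over sites.
   When the d(k, .) determine the marginals, a reweighting of \<mu> turns this factorization into
   independence of the coordinates. *)

theory Submission
  imports Defs
begin

text \<open>\<open>d k\<close> need not be a product of \<open>k\<close> factors \<open>d 1\<close>,
  so one site carrying \<open>k\<close> particles has to be treated as a block, and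
  \<open>d k (\<eta> x)\<close> is averaged over x for each k separately. The average is tested
  against weights such as \<open>D \<xi>\<close>, about which domination first gives only
  integrability; passing to the limit under the integral therefore requires averages that are
  bounded by a constant, and this is why the uniform bound precedes the averaging. The scale
  \<open>4^j\<close> comes from the second moments: averages over at least m sites differ by O(1/m)
  in mean square, so m = \<open>4^j\<close> makes the differences summable in mean. Factorized
  expectations only say that a weight is uncorrelated with the functions \<open>d k\<close> at a
  further site. Determinacy compares probability measures, whereas the weight may change sign.
  Adding a constant turns it into a density, which is possible because the uniform site bound also
  bounds the weights.\<close>

text \<open>By Tonelli the sum of the absolute values has a finite integral, hence is finite almost
  everywhere. This turns a rate in mean into almost sure convergence.\<close>

lemma AE_summable_of_geometric_L1:
  fixes f :: "nat \<Rightarrow> 'a \<Rightarrow> real"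
  assumes int: "\<And>j. integrable M (f j)"
    and bound: "\<And>j. (\<integral>x. \<bar>f j x\<bar> \<partial>M) \<le> B * (1/2)^j"
  shows "AE x in M. summable (\<lambda>j. f j x)"
proof -
  have [measurable]: "f j \<in> borel_measurable M" for j using int by auto
  have "(\<integral>\<^sup>+x. (suminf (\<lambda>j. ennreal \<bar>f j x\<bar>)) \<partial>M) = suminf (\<lambda>j. \<integral>\<^sup>+x. ennreal \<bar>f j x\<bar> \<partial>M)"
    by (rule nn_integral_suminf) auto
  also have "\<dots> = suminf (\<lambda>j. ennreal (\<integral>x. \<bar>f j x\<bar> \<partial>M))"
    using int by (intro suminf_cong nn_integral_eq_integral) auto
  also have "\<dots> < \<top>"
  proof -
    have s: "summable (\<lambda>j. \<integral>x. \<bar>f j x\<bar> \<partial>M)"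
      by (rule summable_comparison_test[of _ "\<lambda>j. B * (1/2)^j"])
         (use bound in \<open>auto intro!: summable_mult summable_geometric\<close>)
    show ?thesis by (subst suminf_ennreal2[OF _ s]) auto
  qed
  finally have "AE x in M. (suminf (\<lambda>j. ennreal \<bar>f j x\<bar>)) \<noteq> \<infinity>"
    by (intro nn_integral_PInf_AE) auto
  then show ?thesis
  proof eventually_elim
    case (elim x)
    then have "summable (\<lambda>j. \<bar>f j x\<bar>)" by (intro summable_suminf_not_top) auto
    then show ?case by (rule summable_rabs_cancel)
  qed
qed

section \<open>Translation-invariant ergodic measures\<close>

text \<open>The sites form an arbitrary countably infinite abelian group; the lattice is one
  instance. Countability allows almost sure statements to hold for all sites and all shifts at
  once.\<close>

locale ergodic_field = prob_space \<mu>
  for \<mu> :: "('v::{ab_group_add,countable} \<Rightarrow> real) measure" +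
  fixes E :: "real set"
  assumes sets_eq [measurable_cong]: "sets \<mu> = sets (configs E)"
    and invariant: "translation_invariant \<mu>"
    and ergodic: "translation_ergodic \<mu>"
    and infinite_sites: "infinite (UNIV :: 'v set)"
begin

lemma space_eq: "space \<mu> = {\<eta>. \<forall>x. \<eta> x \<in> E}"
  using sets_eq_imp_space_eq[OF sets_eq]
  by (auto simp: configs_def space_PiM site_measurable_def space_restrict_space)

lemma measurable_site [measurable]: "(\<lambda>\<eta>. \<eta> x) \<in> \<mu> \<rightarrow>\<^sub>M site_measurable E"
  unfolding measurable_cong_sets[OF sets_eq refl] configs_def
  by (rule measurable_component_singleton) simp

lemma measurable_shift [measurable]: "shift z \<in> \<mu> \<rightarrow>\<^sub>M \<mu>"
  unfolding measurable_cong_sets[OF refl sets_eq] unfolding configs_def shift_def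
  by (rule measurable_PiM_single') (auto simp: space_eq site_measurable_def space_restrict_space
        intro: measurable_site[unfolded site_measurable_def])

lemma shift_in_space: "\<eta> \<in> space \<mu> \<Longrightarrow> shift z \<eta> \<in> space \<mu>"
  by (simp add: space_eq shift_def)

lemma distr_shift: "distr \<mu> \<mu> (shift z) = \<mu>"
  using invariant by (simp add: translation_invariant_def)

lemma AE_shift: "AE \<eta> in \<mu>. P \<eta> \<Longrightarrow> AE \<eta> in \<mu>. P (shift z \<eta>)"
  using AE_distrD[OF measurable_shift, of P z] by (simp only: distr_shift)

lemma integral_shift:
  fixes f :: "('v \<Rightarrow> real) \<Rightarrow> real"
  assumes "f \<in> borel_measurable \<mu>"
  shows "(\<integral>\<eta>. f (shift z \<eta>) \<partial>\<mu>) = (\<integral>\<eta>. f \<eta> \<partial>\<mu>)"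
  using integral_distr[OF measurable_shift assms, of z] by (simp add: distr_shift)

lemma shift_shift: "shift z (shift w \<eta>) = shift (z + w) (\<eta> :: 'v \<Rightarrow> real)"
  by (simp add: shift_def add.assoc)

text \<open>A one-sided closure condition is enough because shifts are invertible: applying it to
  \<open>- z\<close> gives the other inclusion, so the event is strictly invariant and the zero-one
  law applies.\<close>

lemma AE_of_shift_closed:
  assumes [measurable]: "{\<eta>\<in>space \<mu>. P \<eta>} \<in> sets \<mu>"
    and inv: "\<And>z \<eta>. \<eta> \<in> space \<mu> \<Longrightarrow> P \<eta> \<Longrightarrow> P (shift z \<eta>)"
    and not0: "\<not> (AE \<eta> in \<mu>. \<not> P \<eta>)"
  shows "AE \<eta> in \<mu>. P \<eta>"
proof -
  let ?A = "{\<eta>\<in>space \<mu>. P \<eta>}"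
  have "shift z -` ?A \<inter> space \<mu> = ?A" for z
  proof (intro equalityI subsetI)
    fix \<eta> assume "\<eta> \<in> shift z -` ?A \<inter> space \<mu>"
    then have "\<eta> \<in> space \<mu>" "P (shift (- z) (shift z \<eta>))" by (auto intro!: inv)
    then show "\<eta> \<in> ?A" by (simp add: shift_shift) (simp add: shift_def)
  qed (auto intro: inv shift_in_space)
  then have "prob ?A = 0 \<or> prob ?A = 1"
    using ergodic assms(1) unfolding translation_ergodic_def by blast
  moreover have "prob ?A \<noteq> 0"
    using not0 by (subst (asm) AE_iff_measurable[OF assms(1)]) (auto simp: emeasure_eq_measure)
  ultimately show ?thesis using AE_prob_1[of ?A] by auto
qed

text \<open>Ergodicity speaks of strictly invariant sets, while X is invariant only almost surely.
  The event that X stays below its mean a along the whole orbit is strictly invariant. It is not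
  null, as otherwise X > a almost surely, which contradicts the mean. So a - X is nonnegative with
  integral 0.\<close>

lemma shift_invariant_AE_const:
  fixes X :: "('v \<Rightarrow> real) \<Rightarrow> real"
  assumes int: "integrable \<mu> X"
    and inv: "\<And>z. AE \<eta> in \<mu>. X (shift z \<eta>) = X \<eta>"
  shows "AE \<eta> in \<mu>. X \<eta> = expectation X"
proof -
  have [measurable]: "X \<in> borel_measurable \<mu>" using int by auto
  let ?a = "expectation X"
  have all: "AE \<eta> in \<mu>. \<forall>z. X (shift z \<eta>) = X \<eta>"
    using inv by (simp add: AE_all_countable)
  have "AE \<eta> in \<mu>. \<forall>z. X (shift z \<eta>) \<le> ?a"
  proof (rule AE_of_shift_closed)
    show "{\<eta>\<in>space \<mu>. \<forall>z. X (shift z \<eta>) \<le> ?a} \<in> sets \<mu>" by measurable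
    show "\<not> (AE \<eta> in \<mu>. \<not> (\<forall>z. X (shift z \<eta>) \<le> ?a))"
    proof
      assume "AE \<eta> in \<mu>. \<not> (\<forall>z. X (shift z \<eta>) \<le> ?a)"
      with all have "AE \<eta> in \<mu>. ?a < X \<eta>" by eventually_elim (auto simp: not_le)
      from integral_less_AE_space[OF _ int this] show False by (simp add: prob_space emeasure_space_1)
    qed
  qed (simp add: shift_shift)
  with all have le: "AE \<eta> in \<mu>. 0 \<le> ?a - X \<eta>" by eventually_elim auto
  have "AE \<eta> in \<mu>. ?a - X \<eta> = 0"
    using int le by (subst integral_nonneg_eq_0_iff_AE[symmetric]) (auto simp: prob_space)
  then show ?thesis by eventually_elim simp
qed

text \<open>The bound assumed may depend on the configuration. The events "bounded by n at all
  sites" are shift-closed and exhaust the space, so one of them is not null and therefore has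
  probability 1.\<close>

lemma AE_uniform_site_bound:
  fixes h :: "real \<Rightarrow> real"
  assumes [measurable]: "h \<in> borel_measurable (site_measurable E)"
    and bounded: "\<And>\<eta>. \<eta> \<in> space \<mu> \<Longrightarrow> \<exists>C. \<forall>x. \<bar>h (\<eta> x)\<bar> \<le> C"
  shows "\<exists>C. AE \<eta> in \<mu>. \<forall>x. \<bar>h (\<eta> x)\<bar> \<le> C"
proof -
  let ?P = "\<lambda>n \<eta>. \<forall>x. \<bar>h (\<eta> x)\<bar> \<le> real n"
  have "\<exists>n. \<not> (AE \<eta> in \<mu>. \<not> ?P n \<eta>)"
  proof (rule ccontr)
    assume "\<not> ?thesis"
    then have "AE \<eta> in \<mu>. \<forall>n. \<not> ?P n \<eta>" by (simp only: AE_all_countable) simp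
    then have "AE \<eta> in \<mu>. False"
    proof (rule AE_mp, intro AE_I2 impI)
      fix \<eta> assume "\<eta> \<in> space \<mu>" and none: "\<forall>n. \<not> ?P n \<eta>"
      then obtain C where "\<forall>x. \<bar>h (\<eta> x)\<bar> \<le> C" using bounded by blast
      moreover obtain n where "C \<le> real n" using real_arch_simple by blast
      ultimately show False using none order_trans by blast
    qed
    then show False by simp
  qed
  then obtain n where "\<not> (AE \<eta> in \<mu>. \<not> ?P n \<eta>)" ..
  then have "AE \<eta> in \<mu>. ?P n \<eta>"
    by (intro AE_of_shift_closed) (measurable, simp add: shift_def)
  then show ?thesis by blast
qed

end

section \<open>Spatial averages of a bounded observable\<close>

text \<open>To be used with \<open>h = d k\<close>. The constant \<open>b\<close> is an uncentred
  mixed moment; that it equals the squared mean is not assumed.\<close>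

locale bounded_observable = ergodic_field +
  fixes h :: "real \<Rightarrow> real" and C b :: real
  assumes h_measurable [measurable]: "h \<in> borel_measurable (site_measurable E)"
    and h_bound: "AE \<eta> in \<mu>. \<forall>x. \<bar>h (\<eta> x)\<bar> \<le> C"
    and h_cov: "\<And>x y. x \<noteq> y \<Longrightarrow> (\<integral>\<eta>. h (\<eta> x) * h (\<eta> y) \<partial>\<mu>) = b"
begin

definition avg :: "'a set \<Rightarrow> ('a \<Rightarrow> real) \<Rightarrow> real" where
  "avg S \<eta> = (\<Sum>x\<in>S. h (\<eta> x)) / card S"

lemma avg_measurable [measurable]: "avg S \<in> borel_measurable \<mu>"
  unfolding avg_def by measurable

lemma integrable_obs: "integrable \<mu> (\<lambda>\<eta>. h (\<eta> x))"
  by (rule integrable_const_bound[where B = C]) (use h_bound in \<open>auto elim!: eventually_mono\<close>)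

lemma C_nonneg: "0 \<le> C"
proof -
  have "AE \<eta> in \<mu>. 0 \<le> C" using h_bound
    by eventually_elim (meson abs_ge_zero order_trans)
  then show ?thesis by simp
qed

lemma prod_bound: "AE \<eta> in \<mu>. \<forall>x y. \<bar>h (\<eta> x) * h (\<eta> y)\<bar> \<le> C * C"
  using h_bound by eventually_elim (auto simp: abs_mult intro!: mult_mono intro: C_nonneg)

lemma integrable_obs_prod: "integrable \<mu> (\<lambda>\<eta>. h (\<eta> x) * h (\<eta> y))"
  by (rule integrable_const_bound[where B = "C * C"]) (use prod_bound in \<open>auto elim!: eventually_mono\<close>)

lemma cov_deviation: "\<bar>(\<integral>\<eta>. h (\<eta> x) * h (\<eta> y) \<partial>\<mu>) - b\<bar> \<le> (if y = x then C * C + \<bar>b\<bar> else 0)"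
proof (cases "y = x")
  case True
  have bd: "AE \<eta> in \<mu>. \<bar>h (\<eta> x) * h (\<eta> x)\<bar> \<le> C * C"
    using prod_bound by eventually_elim blast
  have "\<bar>\<integral>\<eta>. h (\<eta> x) * h (\<eta> x) \<partial>\<mu>\<bar> \<le> (\<integral>\<eta>. \<bar>h (\<eta> x) * h (\<eta> x)\<bar> \<partial>\<mu>)"
    by (rule integral_abs_bound)
  also have "\<dots> \<le> (\<integral>\<eta>. C * C \<partial>\<mu>)"
    using integrable_obs_prod[of x x] bd
    by (intro integral_mono_AE Bochner_Integration.integrable_abs) auto
  finally have "\<bar>\<integral>\<eta>. h (\<eta> x) * h (\<eta> x) \<partial>\<mu>\<bar> \<le> C * C" by (simp add: prob_space)
  then have "\<bar>(\<integral>\<eta>. h (\<eta> x) * h (\<eta> x) \<partial>\<mu>) - b\<bar> \<le> C * C + \<bar>b\<bar>" by linarith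
  then show ?thesis using True by simp
qed (use h_cov in auto)

lemma avg_bound:
  assumes "finite S"
  shows "AE \<eta> in \<mu>. \<bar>avg S \<eta>\<bar> \<le> C"
  using h_bound
proof eventually_elim
  case (elim \<eta>)
  have "\<bar>\<Sum>x\<in>S. h (\<eta> x)\<bar> \<le> (\<Sum>x\<in>S. C)"
    by (rule order_trans[OF sum_abs sum_mono]) (use elim in auto)
  then show ?case
    using C_nonneg by (cases "card S = 0") (auto simp: avg_def field_simps)
qed

lemma integrable_avg: "finite S \<Longrightarrow> integrable \<mu> (avg S)"
  unfolding avg_def using integrable_obs by auto

lemma avg_mult:
  "avg S \<eta> * avg T \<eta> = (\<Sum>x\<in>S. \<Sum>y\<in>T. h (\<eta> x) * h (\<eta> y)) / (card S * card T)"
  by (simp add: avg_def sum_product)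

lemma integrable_avg_mult: "finite S \<Longrightarrow> finite T \<Longrightarrow> integrable \<mu> (\<lambda>\<eta>. avg S \<eta> * avg T \<eta>)"
  unfolding avg_mult using integrable_obs_prod by auto

text \<open>In the double sum only diagonal pairs deviate from \<open>b\<close>, and each x in
  \<open>S\<close> meets at most one of them. The deviation is thus at most \<open>card S\<close>
  times a constant before division by \<open>card S * card T\<close>, however S and T
  overlap.\<close>

lemma avg_cov_deviation:
  assumes S: "finite S" "S \<noteq> {}" and T: "finite T" "T \<noteq> {}"
  shows "\<bar>(\<integral>\<eta>. avg S \<eta> * avg T \<eta> \<partial>\<mu>) - b\<bar> \<le> (C * C + \<bar>b\<bar>) / card T"
proof -
  let ?c = "\<lambda>x y. (\<integral>\<eta>. h (\<eta> x) * h (\<eta> y) \<partial>\<mu>)" and ?B = "C * C + \<bar>b\<bar>"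
  have pos: "0 < real (card S)" "0 < real (card T)" using S T by (auto simp: card_gt_0_iff)
  have B: "0 \<le> ?B" by simp
  have "(\<integral>\<eta>. avg S \<eta> * avg T \<eta> \<partial>\<mu>) = (\<Sum>x\<in>S. \<Sum>y\<in>T. ?c x y) / (card S * card T)"
    unfolding avg_mult using integrable_obs_prod by (simp add: Bochner_Integration.integral_sum)
  also have "\<dots> - b = (\<Sum>x\<in>S. \<Sum>y\<in>T. ?c x y - b) / (card S * card T)"
    using pos by (simp add: sum_subtractf field_simps)
  finally have eq: "(\<integral>\<eta>. avg S \<eta> * avg T \<eta> \<partial>\<mu>) - b = \<dots>" .
  have "\<bar>\<Sum>x\<in>S. \<Sum>y\<in>T. ?c x y - b\<bar> \<le> (\<Sum>x\<in>S. \<Sum>y\<in>T. if y = x then ?B else 0)"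
    by (intro order_trans[OF sum_abs] sum_mono order_trans[OF sum_abs] cov_deviation)
  also have "\<dots> \<le> (\<Sum>x\<in>S. ?B)"
    using T B by (intro sum_mono) (simp add: sum.delta')
  finally have "\<bar>\<Sum>x\<in>S. \<Sum>y\<in>T. ?c x y - b\<bar> \<le> card S * ?B" by simp
  then show ?thesis unfolding eq using pos by (simp add: abs_div field_simps)
qed

text \<open>After expanding the square, \<open>b\<close> enters with total weight 1 + 1 - 2 = 0.
  What remains are the deviations of the three moments with weights 1, 1 and 2, which gives the
  factor 4.\<close>

lemma avg_diff_sq:
  assumes S: "finite S" "m \<le> card S" and T: "finite T" "m \<le> card T" and m: "0 < m"
  shows "(\<integral>\<eta>. (avg S \<eta> - avg T \<eta>)\<^sup>2 \<partial>\<mu>) \<le> 4 * (C * C + \<bar>b\<bar>) / m"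
proof -
  let ?B = "C * C + \<bar>b\<bar>" and ?e = "\<lambda>S T. (\<integral>\<eta>. avg S \<eta> * avg T \<eta> \<partial>\<mu>)"
  have ne: "S \<noteq> {}" "T \<noteq> {}" using S T m by auto
  have *: "(C * C + \<bar>b\<bar>) / card U \<le> ?B / m" if "m \<le> card U" for U :: "'a set"
    using that m by (intro divide_left_mono) auto
  have "(\<integral>\<eta>. (avg S \<eta> - avg T \<eta>)\<^sup>2 \<partial>\<mu>) =
      (\<integral>\<eta>. avg S \<eta> * avg S \<eta> + avg T \<eta> * avg T \<eta> - 2 * (avg S \<eta> * avg T \<eta>) \<partial>\<mu>)"
    by (intro Bochner_Integration.integral_cong) (auto simp: power2_eq_square algebra_simps)
  also have "\<dots> = ?e S S + ?e T T - 2 * ?e S T"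
    using integrable_avg_mult S T by simp
  also have "\<dots> \<le> 4 * (?B / m)"
    using avg_cov_deviation[of S S] avg_cov_deviation[of T T] avg_cov_deviation[of S T]
      S T ne *[of S] *[of T] by linarith
  finally show ?thesis by simp
qed

text \<open>The mean square is O(\<open>4^-j\<close>). To pass to the mean,
  \<open>\<bar>u\<bar> \<le> \<epsilon>/2 + u^2/(2\<epsilon>)\<close> is integrated with \<epsilon>
  = \<open>2^-j\<close>, the value at which both terms have order \<open>2^-j\<close>.\<close>

lemma avg_diff_L1:
  assumes S: "finite S" "4 ^ j \<le> card S" and T: "finite T" "4 ^ j \<le> card T"
  shows "(\<integral>\<eta>. \<bar>avg S \<eta> - avg T \<eta>\<bar> \<partial>\<mu>) \<le> (1 + 4 * (C * C + \<bar>b\<bar>)) / 2 * (1/2)^j"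
proof -
  let ?X = "\<lambda>\<eta>. avg S \<eta> - avg T \<eta>" and ?B = "C * C + \<bar>b\<bar>"
  have int2: "integrable \<mu> (\<lambda>\<eta>. (?X \<eta>)\<^sup>2)"
    unfolding power2_eq_square right_diff_distrib left_diff_distrib
    by (intro Bochner_Integration.integrable_diff integrable_avg_mult S T)
  have amgm: "\<bar>u\<bar> \<le> (1/2)^j / 2 + 2^j / 2 * u\<^sup>2" for u :: real
  proof -
    have "0 \<le> (2^j * \<bar>u\<bar> - 1)\<^sup>2 / (2 * 2 ^ j)" by simp
    also have "\<dots> = (1/2)^j / 2 + 2^j / 2 * u\<^sup>2 - \<bar>u\<bar>"
      by (simp add: power2_diff power_divide field_simps power2_eq_square)
    finally show ?thesis by simp
  qed
  have "(\<integral>\<eta>. \<bar>?X \<eta>\<bar> \<partial>\<mu>) \<le> (\<integral>\<eta>. (1/2)^j / 2 + 2^j / 2 * (?X \<eta>)\<^sup>2 \<partial>\<mu>)"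
    using integrable_avg S T int2 by (intro integral_mono amgm) auto
  also have "\<dots> = (1/2)^j / 2 + 2^j / 2 * (\<integral>\<eta>. (?X \<eta>)\<^sup>2 \<partial>\<mu>)"
    using int2 by (simp add: prob_space)
  also have "\<dots> \<le> (1/2)^j / 2 + 2^j / 2 * (4 * ?B / real (4 ^ j))"
    using avg_diff_sq[OF S T] by (intro add_left_mono mult_left_mono) auto
  also have "\<dots> = (1 + 4 * ?B) / 2 * (1/2)^j"
  proof -
    have "(4::real)^j = 2^j * 2^j" by (simp flip: power_mult_distrib)
    then show ?thesis by (simp add: field_simps)
  qed
  finally show ?thesis .
qed

lemma avg_shift: "avg S (shift z \<eta>) = avg ((\<lambda>x. x + z) ` S) \<eta>"
proof -
  have "inj_on (\<lambda>x. x + z) S" by (auto simp: inj_on_def)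
  then show ?thesis by (simp add: avg_def shift_def sum.reindex card_image)
qed

text \<open>Averages over two sets of at least \<open>4 ^ j\<close> sites are within \<open>O(2 ^ -j)\<close> in \<open>L\<^sup>1\<close>, whatever the
  sets are. Hence the averages converge almost everywhere, and their limit does not change when
  the sets are translated, so it is constant by ergodicity.\<close>

lemma AE_avg_tendsto:
  fixes e :: "nat \<Rightarrow> 'a"
  assumes e: "inj e"
  shows "AE \<eta> in \<mu>. (\<lambda>j. avg (e ` {..<4^j}) \<eta>) \<longlonglongrightarrow> (\<integral>\<eta>. h (\<eta> 0) \<partial>\<mu>)"
proof -
  define S where "S j = e ` {..<4^j}" for j :: nat
  have S: "finite (S j)" "card (S j) = 4 ^ j" for j
    using e by (auto simp: S_def card_image inj_on_subset)
  have "AE \<eta> in \<mu>. summable (\<lambda>j. avg (S (Suc j)) \<eta> - avg (S j) \<eta>)"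
    using integrable_avg S
    by (intro AE_summable_of_geometric_L1[where B = "(1 + 4 * (C * C + \<bar>b\<bar>)) / 2"] avg_diff_L1) auto
  then have conv: "AE \<eta> in \<mu>. convergent (\<lambda>j. avg (S j) \<eta>)"
  proof eventually_elim
    case (elim \<eta>)
    then obtain s where "(\<lambda>n. \<Sum>j<n. avg (S (Suc j)) \<eta> - avg (S j) \<eta>) \<longlonglongrightarrow> s"
      unfolding summable_def sums_def by blast
    then have "(\<lambda>n. avg (S n) \<eta> - avg (S 0) \<eta>) \<longlonglongrightarrow> s" by (subst (asm) sum_lessThan_telescope)
    from tendsto_add[OF this tendsto_const[of "avg (S 0) \<eta>"]] show ?case
      by (auto simp: convergent_def)
  qed
  define X where "X \<eta> = lim (\<lambda>j. avg (S j) \<eta>)" for \<eta>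
  have [measurable]: "X \<in> borel_measurable \<mu>" unfolding X_def by measurable
  have lim: "AE \<eta> in \<mu>. (\<lambda>j. avg (S j) \<eta>) \<longlonglongrightarrow> X \<eta>"
    using conv by eventually_elim (simp add: X_def convergent_LIMSEQ_iff)
  have bd: "AE \<eta> in \<mu>. \<forall>j. \<bar>avg (S j) \<eta>\<bar> \<le> C"
    using avg_bound S by (simp add: AE_all_countable)
  have "AE \<eta> in \<mu>. \<bar>X \<eta>\<bar> \<le> C"
    using lim bd by eventually_elim (auto intro!: LIMSEQ_le_const2[OF tendsto_rabs])
  then have int: "integrable \<mu> X" by (intro integrable_const_bound[where B = C]) auto
  have "AE \<eta> in \<mu>. X (shift z \<eta>) = X \<eta>" for z
  proof -
    have "AE \<eta> in \<mu>. summable (\<lambda>j. avg ((\<lambda>x. x + z) ` S j) \<eta> - avg (S j) \<eta>)"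
    proof (intro AE_summable_of_geometric_L1[where B = "(1 + 4 * (C * C + \<bar>b\<bar>)) / 2"] avg_diff_L1)
      show "4 ^ j \<le> card ((\<lambda>x. x + z) ` S j)" for j
        using S by (subst card_image) (auto simp: inj_on_def)
    qed (use integrable_avg S in auto)
    moreover have "AE \<eta> in \<mu>. (\<lambda>j. avg ((\<lambda>x. x + z) ` S j) \<eta>) \<longlonglongrightarrow> X (shift z \<eta>)"
      using AE_shift[OF lim, of z] by (simp add: avg_shift)
    ultimately show ?thesis using lim
    proof eventually_elim
      case (elim \<eta>)
      have "(\<lambda>j. avg ((\<lambda>x. x + z) ` S j) \<eta> - avg (S j) \<eta>) \<longlonglongrightarrow> X (shift z \<eta>) - X \<eta>"
        using elim by (intro tendsto_diff)
      with summable_LIMSEQ_zero[OF elim(1)] have "X (shift z \<eta>) - X \<eta> = 0"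
        by (rule LIMSEQ_unique[symmetric])
      then show ?case by simp
    qed
  qed
  from shift_invariant_AE_const[OF int this]
  have const: "AE \<eta> in \<mu>. X \<eta> = expectation X" .
  \<comment> \<open>The constant is identified through its expectation: by translation invariance
    every average has the mean of a single site.\<close>
  have "(\<lambda>j. expectation (avg (S j))) \<longlonglongrightarrow> expectation X"
    by (rule integral_dominated_convergence[where w = "\<lambda>_. C"]) 
       (use lim avg_bound S in auto)
  moreover have "expectation (avg (S j)) = (\<integral>\<eta>. h (\<eta> 0) \<partial>\<mu>)" for j
  proof -
    have const: "(\<integral>\<eta>. h (\<eta> x) \<partial>\<mu>) = (\<integral>\<eta>. h (\<eta> 0) \<partial>\<mu>)" for x
      using integral_shift[of "\<lambda>\<eta>. h (\<eta> 0)" x] by (simp add: shift_def)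
    have "expectation (avg (S j)) = (\<Sum>x\<in>S j. \<integral>\<eta>. h (\<eta> x) \<partial>\<mu>) / card (S j)"
      using integrable_obs by (simp add: avg_def[abs_def] Bochner_Integration.integral_sum)
    then show ?thesis by (subst (asm) const) (simp add: S)
  qed
  ultimately have "expectation X = (\<integral>\<eta>. h (\<eta> 0) \<partial>\<mu>)"
    by (simp add: LIMSEQ_const_iff)
  with lim const show ?thesis unfolding S_def by auto
qed

text \<open>Average the hypothesis over sites outside F: the integral of W times the average is w at
  every stage, while dominated convergence, with bound \<open>C * \<bar>W \<eta>\<bar>\<close>,
  sends it to the product of the means. A constant sequence equals its limit.\<close>

lemma expectation_mult_obs:
  assumes W: "integrable \<mu> W" and F: "finite F"
    and w: "\<And>x. x \<notin> F \<Longrightarrow> (\<integral>\<eta>. W \<eta> * h (\<eta> x) \<partial>\<mu>) = w"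
  shows "w = expectation W * (\<integral>\<eta>. h (\<eta> 0) \<partial>\<mu>)"
proof -
  have [measurable]: "W \<in> borel_measurable \<mu>" using W by auto
  have "infinite (- F)" using F infinite_sites by (simp add: finite_compl)
  then obtain e :: "nat \<Rightarrow> 'a" where e: "inj e" "range e \<subseteq> - F"
    using infinite_countable_subset by blast
  define S where "S j = e ` {..<4^j}" for j :: nat
  have S: "finite (S j)" "card (S j) = 4 ^ j" "S j \<subseteq> - F" for j
    using e by (auto simp: S_def card_image inj_on_subset)
  have int: "integrable \<mu> (\<lambda>\<eta>. W \<eta> * h (\<eta> x))" for x
  proof (rule Bochner_Integration.integrable_bound)
    show "integrable \<mu> (\<lambda>\<eta>. C * W \<eta>)" using W by simp
    show "AE \<eta> in \<mu>. norm (W \<eta> * h (\<eta> x)) \<le> norm (C * W \<eta>)"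
      using h_bound by eventually_elim
        (use C_nonneg in \<open>auto simp: abs_mult mult.commute[of C] intro!: mult_left_mono\<close>)
  qed simp
  have "(\<lambda>j. \<integral>\<eta>. W \<eta> * avg (S j) \<eta> \<partial>\<mu>) \<longlonglongrightarrow> (\<integral>\<eta>. W \<eta> * (\<integral>\<eta>. h (\<eta> 0) \<partial>\<mu>) \<partial>\<mu>)"
  proof (rule integral_dominated_convergence[where w = "\<lambda>\<eta>. C * \<bar>W \<eta>\<bar>"])
    show "AE \<eta> in \<mu>. norm (W \<eta> * avg (S j) \<eta>) \<le> C * \<bar>W \<eta>\<bar>" for j
      using avg_bound[OF S(1)[of j]] by eventually_elim
        (auto simp: abs_mult mult.commute[of C] intro!: mult_left_mono)
    show "AE \<eta> in \<mu>. (\<lambda>j. W \<eta> * avg (S j) \<eta>) \<longlonglongrightarrow> W \<eta> * (\<integral>\<eta>. h (\<eta> 0) \<partial>\<mu>)"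
      using AE_avg_tendsto[OF e(1)] unfolding S_def
      by eventually_elim (auto intro!: tendsto_mult)
  qed (use W in auto)
  moreover have "(\<integral>\<eta>. W \<eta> * avg (S j) \<eta> \<partial>\<mu>) = w" for j
  proof -
    have "(\<integral>\<eta>. W \<eta> * avg (S j) \<eta> \<partial>\<mu>) = (\<integral>\<eta>. (\<Sum>x\<in>S j. W \<eta> * h (\<eta> x)) / 4 ^ j \<partial>\<mu>)"
      by (simp add: avg_def S sum_distrib_left)
    also have "\<dots> = (\<Sum>x\<in>S j. \<integral>\<eta>. W \<eta> * h (\<eta> x) \<partial>\<mu>) / 4 ^ j"
      using int by (simp add: Bochner_Integration.integral_sum)
    also have "\<dots> = (\<Sum>x\<in>S j. w) / 4 ^ j"
      using S(3)[of j] w by (intro arg_cong2[where f = "(/)"] sum.cong) auto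
    finally show ?thesis by (simp add: S)
  qed
  ultimately show ?thesis using W by (simp add: LIMSEQ_const_iff)
qed

end

section \<open>Harmonicity of the stationary expectations\<close>

lemma integral_eq_enn2real_diff:
  fixes f :: "'a \<Rightarrow> real"
  assumes "integrable M f"
  shows "(\<integral>\<^sup>+x. ennreal (f x) \<partial>M) < \<infinity>" "(\<integral>\<^sup>+x. ennreal (- f x) \<partial>M) < \<infinity>"
    and "(\<integral>x. f x \<partial>M) = enn2real (\<integral>\<^sup>+x. ennreal (f x) \<partial>M) - enn2real (\<integral>\<^sup>+x. ennreal (- f x) \<partial>M)"
  using assms by (auto simp: real_integrable_def real_lebesgue_integral_def top.not_eq_extremum)

text \<open>Meant for unbounded signed f. Positive and negative parts are treated by
  \<open>nn_integral_bind\<close>. Since \<open>enn2real\<close> maps infinity to 0, both parts must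
  be finite at every x, which \<open>int_N\<close> ensures, and in total, which \<open>int\<close>
  ensures.\<close>

lemma integral_bind_integrable:
  fixes f :: "'b \<Rightarrow> real"
  assumes N: "N \<in> M \<rightarrow>\<^sub>M subprob_algebra B"
    and f [measurable]: "f \<in> borel_measurable B"
    and int: "integrable (M \<bind> N) f"
    and int_N: "\<And>x. x \<in> space M \<Longrightarrow> integrable (N x) f"
  shows "(\<integral>y. f y \<partial>(M \<bind> N)) = (\<integral>x. \<integral>y. f y \<partial>N x \<partial>M)"
proof -
  define p where "p x = (\<integral>\<^sup>+y. ennreal (f y) \<partial>N x)" for x
  define q where "q x = (\<integral>\<^sup>+y. ennreal (- f y) \<partial>N x)" for x
  have f': "(\<lambda>y. ennreal (f y)) \<in> borel_measurable B" "(\<lambda>y. ennreal (- f y)) \<in> borel_measurable B"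
    by measurable
  have [measurable]: "p \<in> borel_measurable M" "q \<in> borel_measurable M"
    unfolding p_def q_def
    by (rule measurable_compose[OF N nn_integral_measurable_subprob_algebra[OF f'(1)]])
       (rule measurable_compose[OF N nn_integral_measurable_subprob_algebra[OF f'(2)]])
  have fin: "p x < \<infinity>" "q x < \<infinity>" "(\<integral>y. f y \<partial>N x) = enn2real (p x) - enn2real (q x)"
    if "x \<in> space M" for x
    using integral_eq_enn2real_diff[OF int_N[OF that]] by (auto simp: p_def q_def)
  have eqs: "(\<integral>\<^sup>+y. ennreal (f y) \<partial>(M \<bind> N)) = (\<integral>\<^sup>+x. p x \<partial>M)"
    "(\<integral>\<^sup>+y. ennreal (- f y) \<partial>(M \<bind> N)) = (\<integral>\<^sup>+x. q x \<partial>M)"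
    unfolding p_def q_def by (rule nn_integral_bind[OF f'(1) N], rule nn_integral_bind[OF f'(2) N])
  have real: "integrable M (\<lambda>x. enn2real (r x))"
    "(\<integral>x. enn2real (r x) \<partial>M) = enn2real (\<integral>\<^sup>+x. r x \<partial>M)"
    if [measurable]: "r \<in> borel_measurable M" and "\<And>x. x \<in> space M \<Longrightarrow> r x < \<infinity>"
      and "(\<integral>\<^sup>+x. r x \<partial>M) < \<infinity>" for r
  proof -
    have *: "(\<integral>\<^sup>+x. ennreal (enn2real (r x)) \<partial>M) = (\<integral>\<^sup>+x. r x \<partial>M)"
      using that by (intro nn_integral_cong) auto
    show "integrable M (\<lambda>x. enn2real (r x))"
      using that * by (intro integrableI_nonneg) auto
    show "(\<integral>x. enn2real (r x) \<partial>M) = enn2real (\<integral>\<^sup>+x. r x \<partial>M)"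
      by (subst integral_eq_nn_integral) (auto simp: *)
  qed
  have "(\<integral>x. \<integral>y. f y \<partial>N x \<partial>M) = (\<integral>x. enn2real (p x) - enn2real (q x) \<partial>M)"
    using fin by (intro Bochner_Integration.integral_cong) auto
  also have "\<dots> = (\<integral>y. f y \<partial>(M \<bind> N))"
    using integral_eq_enn2real_diff[OF int] fin real[of p] real[of q] by (simp add: eqs)
  finally show ?thesis ..
qed

text \<open>A finite configuration is coded by the finite graph of its nonzero values. Countability
  makes the duality function jointly measurable as soon as its sections are, which Fubini
  requires.\<close>

lemma countable_finite_configs: "countable (finite_configs K :: ('v::countable \<Rightarrow> nat) set)"
proof -
  let ?graph = "\<lambda>\<xi> :: 'v \<Rightarrow> nat. (\<lambda>x. (x, \<xi> x)) ` {x. \<xi> x \<noteq> 0}"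
  have "inj_on ?graph (finite_configs K)"
  proof (rule inj_onI)
    fix \<xi> \<zeta> :: "'v \<Rightarrow> nat" assume eq: "?graph \<xi> = ?graph \<zeta>"
    have "\<xi> x = n \<longleftrightarrow> \<zeta> x = n" if "n \<noteq> 0" for x n
    proof -
      have "\<xi> x = n \<longleftrightarrow> (x, n) \<in> ?graph \<xi>" "\<zeta> x = n \<longleftrightarrow> (x, n) \<in> ?graph \<zeta>"
        using that by auto
      then show ?thesis using eq by simp
    qed
    then have "\<xi> x = \<zeta> x" for x by metis
    then show "\<xi> = \<zeta>" by (rule ext)
  qed
  moreover have "?graph ` finite_configs K \<subseteq> {A. finite A}"
    by (auto simp: finite_configs_iff)
  ultimately show ?thesis
    by (intro countable_image_inj_on[of ?graph] countable_subset[OF _ countable_Collect_finite])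
qed

lemma integrable_of_uniform_domination:
  assumes "uniform_domination E K D \<mu>" and "sets \<mu> = sets (configs E)"
    and "D \<xi> \<in> borel_measurable (configs E)" and "\<xi> \<in> finite_configs K"
  shows "integrable \<mu> (D \<xi>)"
proof -
  obtain f where "integrable \<mu> f" and "\<forall>\<eta>\<in>space (configs E). \<forall>\<zeta>\<in>finite_configs K.
      particles \<zeta> = particles \<xi> \<longrightarrow> \<bar>D \<zeta> \<eta>\<bar> \<le> f \<eta>"
    using assms(1) unfolding uniform_domination_def by blast
  with assms(4) have f: "integrable \<mu> f"
    "\<And>\<eta>. \<eta> \<in> space (configs E) \<Longrightarrow> \<bar>D \<xi> \<eta>\<bar> \<le> f \<eta>"
    by auto
  show ?thesis
  proof (rule Bochner_Integration.integrable_bound[OF f(1)])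
    show "D \<xi> \<in> borel_measurable \<mu>"
      using assms(3) by (simp add: measurable_cong_sets[OF assms(2) refl])
    show "AE \<eta> in \<mu>. norm (D \<xi> \<eta>) \<le> norm (f \<eta>)"
      using f(2) sets_eq_imp_space_eq[OF assms(2)] by (force intro!: AE_I2)
  qed
qed

lemma dual_expectation_const:
  fixes D :: "('v::countable \<Rightarrow> nat) \<Rightarrow> ('v \<Rightarrow> real) \<Rightarrow> real"
  assumes P: "markov_semigroup (configs E) P"
    and Q: "markov_semigroup (count_space (finite_configs K)) Q"
    and dual: "dual_processes E K P Q D"
    and cons: "conserves_particles K Q"
    and triv: "bounded_harmonic_triviality K Q"
    and prob: "prob_space \<mu>" and sets_\<mu> [measurable_cong]: "sets \<mu> = sets (configs E)"
    and dom: "uniform_domination E K D \<mu>"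
    and stat: "stationary P \<mu>"
  shows "\<exists>c. \<forall>\<xi>\<in>finite_configs K. particles \<xi> = n \<longrightarrow> (\<integral>\<eta>. D \<xi> \<eta> \<partial>\<mu>) = c"
proof -
  interpret \<mu>: prob_space \<mu> by fact
  let ?C = "finite_configs K :: ('v \<Rightarrow> nat) set"
  have space_\<mu>: "space \<mu> = space (configs E)" by (rule sets_eq_imp_space_eq[OF sets_\<mu>])
  obtain f where f: "integrable \<mu> f"
    and "\<forall>\<eta>\<in>space (configs E). \<forall>\<xi>\<in>?C. particles \<xi> = n \<longrightarrow> \<bar>D \<xi> \<eta>\<bar> \<le> f \<eta>"
    using dom unfolding uniform_domination_def by blast
  then have f_ge: "\<bar>D \<xi> \<eta>\<bar> \<le> f \<eta>"
    if "\<eta> \<in> space \<mu>" "\<xi> \<in> ?C" "particles \<xi> = n" for \<eta> \<xi>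
    using that by (simp add: space_\<mu>)
  have D_meas: "D \<xi> \<in> borel_measurable (configs E)" if "\<xi> \<in> ?C" for \<xi>
    using dual that by (simp add: dual_processes_def)
  have D_int: "integrable \<mu> (D \<xi>)" if "\<xi> \<in> ?C" for \<xi>
    using integrable_of_uniform_domination[OF dom sets_\<mu> D_meas[OF that] that] .
  \<comment> \<open>The dominating function depends on the particle number, so the expectation is
    bounded only on one level at a time. Cutting to level n restores boundedness, and the dual
    dynamics does not see the cut because it conserves particles.\<close>
  define F where "F \<xi> \<eta> = (if particles \<xi> = n then D \<xi> \<eta> else 0)" for \<xi> \<eta>
  define H where "H \<xi> = (\<integral>\<eta>. F \<xi> \<eta> \<partial>\<mu>)" for \<xi>
  have F_int: "integrable \<mu> (F \<xi>)" if "\<xi> \<in> ?C" for \<xi>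
    using D_int[OF that] by (cases "particles \<xi> = n") (auto simp: F_def[abs_def])
  have "\<bar>F \<xi> \<eta>\<bar> \<le> \<bar>f \<eta>\<bar>" if "\<xi> \<in> ?C" "\<eta> \<in> space \<mu>" for \<xi> \<eta>
    using f_ge[OF that(2,1)] by (auto simp: F_def)
  then have F_abs: "(\<integral>\<eta>. \<bar>F \<xi> \<eta>\<bar> \<partial>\<mu>) \<le> (\<integral>\<eta>. \<bar>f \<eta>\<bar> \<partial>\<mu>)" if "\<xi> \<in> ?C" for \<xi>
    using f F_int[OF that] that
    by (intro integral_mono Bochner_Integration.integrable_abs) blast+
  have H_bd: "\<bar>H \<xi>\<bar> \<le> (\<integral>\<eta>. \<bar>f \<eta>\<bar> \<partial>\<mu>)" if "\<xi> \<in> ?C" for \<xi>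
    unfolding H_def by (rule order_trans[OF integral_abs_bound F_abs[OF that]])
  have harmonic: "(\<integral>\<xi>'. H \<xi>' \<partial>Q t \<xi>) = H \<xi>" if t: "0 < t" and \<xi>: "\<xi> \<in> ?C" for t \<xi>
  proof -
    have "Q t \<in> count_space ?C \<rightarrow>\<^sub>M prob_algebra (count_space ?C)"
      using Q t by (simp add: markov_semigroup_def)
    then have "Q t \<xi> \<in> space (prob_algebra (count_space ?C))"
      using \<xi> by (auto dest: measurable_space)
    then have sets_Q [measurable_cong]: "sets (Q t \<xi>) = sets (count_space ?C)"
      and prob_Q: "prob_space (Q t \<xi>)" by (auto simp: space_prob_algebra)
    interpret Q: prob_space "Q t \<xi>" by (rule prob_Q)
    interpret pair_sigma_finite "Q t \<xi>" \<mu> ..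
    have space_Q: "space (Q t \<xi>) = ?C" using sets_eq_imp_space_eq[OF sets_Q] by simp
    have meas_Q: "g \<in> borel_measurable (Q t \<xi>)" for g :: "_ \<Rightarrow> real"
      by (simp add: measurable_cong_sets[OF sets_Q refl])
    have cons_Q: "AE \<xi>' in Q t \<xi>. particles \<xi>' = particles \<xi>"
      using cons t \<xi> by (simp add: conserves_particles_def)
    show ?thesis
    proof (cases "particles \<xi> = n")
      case False
      \<comment> \<open>Started off level n, the dual stays off it almost surely, where
        \<open>H\<close> vanishes.\<close>
      then have "(\<integral>\<xi>'. H \<xi>' \<partial>Q t \<xi>) = (\<integral>\<xi>'. 0 \<partial>Q t \<xi>)"
        using cons_Q by (intro integral_cong_AE meas_Q) (auto elim!: eventually_mono simp: H_def F_def)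
      then show ?thesis using False by (simp add: H_def F_def)
    next
      case True
      have F_meas: "case_prod F \<in> borel_measurable (Q t \<xi> \<Otimes>\<^sub>M \<mu>)"
        unfolding measurable_cong_sets[OF sets_pair_measure_cong[OF sets_Q refl] refl]
        by (rule measurable_pair_measure_countable1[OF countable_finite_configs])
           (use F_int in auto)
      have F_int2: "integrable (Q t \<xi> \<Otimes>\<^sub>M \<mu>) (case_prod F)"
      proof (rule Fubini_integrable[OF F_meas])
        show "integrable (Q t \<xi>) (\<lambda>\<xi>'. \<integral>\<eta>. norm (case (\<xi>', \<eta>) of (x, y) \<Rightarrow> F x y) \<partial>\<mu>)"
          using F_abs by (intro Q.integrable_const_bound[where B = "\<integral>\<eta>. \<bar>f \<eta>\<bar> \<partial>\<mu>"])
            (auto intro!: AE_I2 meas_Q simp: space_Q)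
      qed (use F_int in \<open>auto intro!: AE_I2 simp: space_Q\<close>)
      have "(\<integral>\<xi>'. H \<xi>' \<partial>Q t \<xi>) = (\<integral>\<eta>. \<integral>\<xi>'. F \<xi>' \<eta> \<partial>Q t \<xi> \<partial>\<mu>)"
        unfolding H_def by (rule Fubini_integral[OF F_int2, symmetric])
      also have "\<dots> = (\<integral>\<eta>. \<integral>\<eta>'. D \<xi> \<eta>' \<partial>P t \<eta> \<partial>\<mu>)"
      proof (rule Bochner_Integration.integral_cong[OF refl])
        fix \<eta> assume \<eta>: "\<eta> \<in> space \<mu>"
        have "(\<integral>\<xi>'. F \<xi>' \<eta> \<partial>Q t \<xi>) = (\<integral>\<xi>'. D \<xi>' \<eta> \<partial>Q t \<xi>)"
          using cons_Q True by (intro integral_cong_AE meas_Q) (auto elim!: eventually_mono simp: F_def)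
        also have "\<dots> = (\<integral>\<eta>'. D \<xi> \<eta>' \<partial>P t \<eta>)"
          using dual t \<xi> \<eta> by (simp add: dual_processes_def space_\<mu>)
        finally show "(\<integral>\<xi>'. F \<xi>' \<eta> \<partial>Q t \<xi>) = (\<integral>\<eta>'. D \<xi> \<eta>' \<partial>P t \<eta>)" .
      qed
      also have "\<dots> = (\<integral>\<eta>. D \<xi> \<eta> \<partial>(\<mu> \<bind> P t))"
      proof (rule integral_bind_integrable[symmetric, OF _ D_meas[OF \<xi>]])
        have "P t \<in> configs E \<rightarrow>\<^sub>M prob_algebra (configs E)"
          using P t by (simp add: markov_semigroup_def)
        then show "P t \<in> \<mu> \<rightarrow>\<^sub>M subprob_algebra (configs E)"
          unfolding measurable_cong_sets[OF sets_\<mu> refl] by (rule measurable_prob_algebraD)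
        show "integrable (\<mu> \<bind> P t) (D \<xi>)"
          using D_int[OF \<xi>] stat t by (simp add: stationary_def)
        show "integrable (P t \<eta>) (D \<xi>)" if "\<eta> \<in> space \<mu>" for \<eta>
          using dual t \<xi> that by (simp add: dual_processes_def space_\<mu>)
      qed
      also have "\<dots> = H \<xi>"
        using stat t True by (simp add: stationary_def H_def F_def)
      finally show ?thesis .
    qed
  qed
  have "bounded (H ` ?C)" using H_bd by (auto simp: bounded_iff)
  with harmonic triv obtain \<psi> :: "nat \<Rightarrow> real" where "\<forall>\<xi>\<in>?C. H \<xi> = \<psi> (particles \<xi>)"
    unfolding bounded_harmonic_triviality_def by blast
  then show ?thesis by (intro exI[of _ "\<psi> n"]) (auto simp: H_def F_def)
qed

section \<open>Algebra of factorized duality functions\<close>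

lemma factorized_eq_prod:
  assumes d0: "\<And>e. e \<in> E \<Longrightarrow> d 0 e = 1" and \<eta>: "\<And>x. \<eta> x \<in> E"
    and S: "finite S" "{x. \<xi> x \<noteq> 0} \<subseteq> S"
  shows "factorized d \<xi> \<eta> = (\<Prod>x\<in>S. d (\<xi> x) (\<eta> x))"
  unfolding factorized_def
proof (rule Prod_any.expand_superset[OF S(1)])
  have "d (\<xi> x) (\<eta> x) = 1" if "\<xi> x = 0" for x using that d0[OF \<eta>] by simp
  then show "{x. d (\<xi> x) (\<eta> x) \<noteq> 1} \<subseteq> S" using S(2) by blast
qed

lemma particles_fun_upd:
  assumes "\<xi> \<in> finite_configs K" and "\<xi>(y := k) \<in> finite_configs K" and "\<xi> y = 0"
  shows "particles (\<xi>(y := k)) = particles \<xi> + k"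
proof -
  let ?S = "{x. \<xi> x \<noteq> 0}"
  have S: "finite ?S" "y \<notin> ?S" using assms by (auto simp: finite_configs_iff)
  \<comment> \<open>For \<open>k = 0\<close> the site y is not in the support, so the sum over
    \<open>insert y ?S\<close> may carry a zero term.\<close>
  have *: "particles (\<xi>(y := k)) = (\<Sum>x\<in>insert y ?S. (\<xi>(y := k)) x)"
    unfolding particles_eq_sum[OF assms(2)] using S(1) by (intro sum.mono_neutral_left) auto
  have "(\<Sum>x\<in>insert y ?S. (\<xi>(y := k)) x) = k + (\<Sum>x\<in>?S. (\<xi>(y := k)) x)" using S by simp
  also have "(\<Sum>x\<in>?S. (\<xi>(y := k)) x) = (\<Sum>x\<in>?S. \<xi> x)" using S(2) by (intro sum.cong) auto
  finally show ?thesis unfolding * by (simp add: particles_eq_sum[OF assms(1)])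
qed

section \<open>Factorization of the expectations\<close>

text \<open>Everything the dynamics contributes is collected in \<open>expectation_const\<close>;
  from here on the argument concerns \<mu> alone.\<close>

locale duality_field = ergodic_field +
  fixes K :: "nat set" and d :: "nat \<Rightarrow> real \<Rightarrow> real"
  assumes K: "dual_site_space K"
    and d_0: "\<And>e. e \<in> E \<Longrightarrow> d 0 e = 1"
    and factorized_configs_measurable: "\<And>\<xi>. \<xi> \<in> finite_configs K \<Longrightarrow>
      factorized d \<xi> \<in> borel_measurable (configs E :: ('a \<Rightarrow> real) measure)"
    and dominated: "uniform_domination E K (factorized d) \<mu>"
    and expectation_const: "\<And>n. \<exists>c. \<forall>\<xi>\<in>finite_configs K. particles \<xi> = n \<longrightarrow>
      (\<integral>\<eta>. factorized d \<xi> \<eta> \<partial>\<mu>) = c"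
begin

abbreviation D :: "('a \<Rightarrow> nat) \<Rightarrow> ('a \<Rightarrow> real) \<Rightarrow> real" where "D \<equiv> factorized d"
abbreviation configurations :: "('a \<Rightarrow> nat) set" where "configurations \<equiv> finite_configs K"

lemma zero_in_K [simp]: "0 \<in> K"
  using K by (auto simp: dual_site_space_def)

lemma zero_config [simp]: "(\<lambda>_. 0) \<in> configurations"
  by (simp add: finite_configs_iff)

lemma particles_zero: "particles (\<lambda>_::'a. 0) = 0"
  by (simp add: particles_eq_sum[OF zero_config])

lemma fun_upd_config:
  assumes "\<xi> \<in> configurations" and "k \<in> K"
  shows "\<xi>(y := k) \<in> configurations"
proof -
  have "{x. (\<xi>(y := k)) x \<noteq> 0} \<subseteq> insert y {x. \<xi> x \<noteq> 0}" by auto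
  moreover have "finite (insert y {x. \<xi> x \<noteq> 0})" using assms by (simp add: finite_configs_iff)
  ultimately have "finite {x. (\<xi>(y := k)) x \<noteq> 0}" by (rule finite_subset)
  then show ?thesis using assms by (simp add: finite_configs_iff)
qed

lemma D_eq_prod:
  assumes "\<eta> \<in> space \<mu>" and "finite S" and "{x. \<xi> x \<noteq> 0} \<subseteq> S"
  shows "D \<xi> \<eta> = (\<Prod>x\<in>S. d (\<xi> x) (\<eta> x))"
  using assms by (intro factorized_eq_prod[where E = E] d_0) (auto simp: space_eq)

lemma D_zero: "\<eta> \<in> space \<mu> \<Longrightarrow> D (\<lambda>_. 0) \<eta> = 1"
  by (subst D_eq_prod[where S = "{}"]) auto

text \<open>At an occupied site an update replaces a factor instead of adding one. This is why
  particles are always placed on empty sites.\<close>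

lemma D_fun_upd:
  assumes "\<eta> \<in> space \<mu>" and "\<xi> \<in> configurations" and "\<xi> y = 0"
  shows "D (\<xi>(y := k)) \<eta> = D \<xi> \<eta> * d k (\<eta> y)"
proof -
  let ?S = "{x. \<xi> x \<noteq> 0}"
  have S: "finite ?S" "y \<notin> ?S" using assms by (auto simp: finite_configs_iff)
  have *: "D (\<xi>(y := k)) \<eta> = (\<Prod>x\<in>insert y ?S. d ((\<xi>(y := k)) x) (\<eta> x))"
    using S assms(1) by (intro D_eq_prod) auto
  have "(\<Prod>x\<in>insert y ?S. d ((\<xi>(y := k)) x) (\<eta> x)) = d k (\<eta> y) * (\<Prod>x\<in>?S. d ((\<xi>(y := k)) x) (\<eta> x))" using S by simp
  also have "(\<Prod>x\<in>?S. d ((\<xi>(y := k)) x) (\<eta> x)) = (\<Prod>x\<in>?S. d (\<xi> x) (\<eta> x))"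
    using S(2) by (intro prod.cong) auto
  also have "\<dots> = D \<xi> \<eta>" using S assms(1) by (intro D_eq_prod[symmetric]) auto
  finally show ?thesis unfolding * by (simp only: mult.commute)
qed

lemma D_measurable: "\<xi> \<in> configurations \<Longrightarrow> D \<xi> \<in> borel_measurable \<mu>"
  using factorized_configs_measurable by (simp add: measurable_cong_sets[OF sets_eq refl])

lemma integrable_D: "\<xi> \<in> configurations \<Longrightarrow> integrable \<mu> (D \<xi>)"
  using integrable_of_uniform_domination[OF dominated sets_eq] factorized_configs_measurable by blast

text \<open>Measurability is assumed for the whole product only. It is pulled back along the
  embedding of E as constant configurations, where k particles at the origin give exactly
  \<open>d k e\<close>.\<close>

lemma d_measurable:
  assumes "k \<in> K"
  shows "d k \<in> borel_measurable (site_measurable E)"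
proof -
  let ?\<xi> = "(\<lambda>_::'a. 0)(0 := k)"
  have \<xi>: "?\<xi> \<in> configurations" by (intro fun_upd_config assms zero_config)
  have space_site: "space (site_measurable E) = E"
    by (simp add: site_measurable_def space_restrict_space)
  have "(\<lambda>e _. e) \<in> site_measurable E \<rightarrow>\<^sub>M (configs E :: ('a \<Rightarrow> real) measure)"
    unfolding configs_def by (rule measurable_PiM_single') (auto simp: space_site)
  from measurable_compose[OF this factorized_configs_measurable[OF \<xi>]]
  have "(\<lambda>e. D ?\<xi> (\<lambda>_. e)) \<in> borel_measurable (site_measurable E)" .
  moreover have "D ?\<xi> (\<lambda>_. e) = d k e" if "e \<in> E" for e
    using that by (subst D_fun_upd) (auto simp: space_eq D_zero)
  ultimately show ?thesis by (subst (asm) measurable_cong) (auto simp: space_site)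
qed

lemma pair_config: "k \<in> K \<Longrightarrow> ((\<lambda>_. 0)(x := k))(y := k) \<in> configurations"
  by (intro fun_upd_config zero_config)

lemma D_pair:
  assumes "\<eta> \<in> space \<mu>" and "k \<in> K" and "x \<noteq> y"
  shows "D (((\<lambda>_. 0)(x := k))(y := k)) \<eta> = d k (\<eta> x) * d k (\<eta> y)"
  using assms by (simp add: D_fun_upd fun_upd_config D_zero)

lemma particles_pair:
  assumes "k \<in> K" and "x \<noteq> y"
  shows "particles (((\<lambda>_::'a. 0)(x := k))(y := k)) = 2 * k"
proof -
  have x: "(\<lambda>_. 0)(x := k) \<in> configurations" by (intro fun_upd_config assms zero_config)
  have "particles ((\<lambda>_. 0)(x := k)) = k"
    using particles_fun_upd[OF zero_config x] by (simp add: particles_zero)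
  then show ?thesis
    using particles_fun_upd[OF x pair_config[OF assms(1)]] assms(2) by simp
qed

text \<open>At a fixed configuration, domination with \<open>2 * k\<close> particles, \<open>k\<close> at \<open>x\<close> and \<open>k\<close> at \<open>y\<close>, bounds
  \<open>d k (\<eta> x) * d k (\<eta> y)\<close> uniformly in \<open>x \<noteq> y\<close>.\<close>

lemma sites_bounded:
  assumes k: "k \<in> K" and \<eta>: "\<eta> \<in> space \<mu>"
  shows "\<exists>C. \<forall>x. \<bar>d k (\<eta> x)\<bar> \<le> C"
\<comment> \<open>A site with a nonzero value serves as reference: dividing the bound on the
  products by that value bounds every other site.\<close>
proof (cases "\<exists>x. d k (\<eta> x) \<noteq> 0")
  case True
  then obtain x where x: "d k (\<eta> x) \<noteq> 0" ..
  obtain f where f: "\<forall>\<eta>\<in>space (configs E). \<forall>\<xi>\<in>configurations.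
      particles \<xi> = 2 * k \<longrightarrow> \<bar>D \<xi> \<eta>\<bar> \<le> f \<eta>"
    using dominated unfolding uniform_domination_def by blast
  have "\<bar>d k (\<eta> y)\<bar> \<le> f \<eta> / \<bar>d k (\<eta> x)\<bar>" if "x \<noteq> y" for y
  proof -
    have "\<bar>D (((\<lambda>_. 0)(x := k))(y := k)) \<eta>\<bar> \<le> f \<eta>"
      using f \<eta> pair_config[OF k] particles_pair[OF k that] sets_eq_imp_space_eq[OF sets_eq] by simp
    then show ?thesis using x
      by (simp add: D_pair[OF \<eta> k that] abs_mult field_simps)
  qed
  then have "\<bar>d k (\<eta> y)\<bar> \<le> max \<bar>d k (\<eta> x)\<bar> (f \<eta> / \<bar>d k (\<eta> x)\<bar>)" for y
    by (cases "x = y") (auto simp: le_max_iff_disj)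
  then show ?thesis by blast
qed (auto intro!: exI[of _ 0])

lemma AE_site_bound:
  assumes "k \<in> K"
  shows "\<exists>C. AE \<eta> in \<mu>. \<forall>x. \<bar>d k (\<eta> x)\<bar> \<le> C"
  by (rule AE_uniform_site_bound[OF d_measurable sites_bounded]) (use assms in auto)

lemma expectation_mult_site:
  assumes k: "k \<in> K" and W: "integrable \<mu> W" and F: "finite F"
    and w: "\<And>x. x \<notin> F \<Longrightarrow> (\<integral>\<eta>. W \<eta> * d k (\<eta> x) \<partial>\<mu>) = w"
  shows "w = expectation W * (\<integral>\<eta>. d k (\<eta> 0) \<partial>\<mu>)"
proof -
  obtain C where C: "AE \<eta> in \<mu>. \<forall>x. \<bar>d k (\<eta> x)\<bar> \<le> C" using AE_site_bound[OF k] by blast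
  \<comment> \<open>The mixed moments of \<open>d k\<close> at two distinct sites are expectations
    for configurations with \<open>2 * k\<close> particles, hence all equal.\<close>
  obtain b where b: "\<forall>\<xi>\<in>configurations. particles \<xi> = 2 * k \<longrightarrow> (\<integral>\<eta>. D \<xi> \<eta> \<partial>\<mu>) = b"
    using expectation_const by blast
  interpret bounded_observable \<mu> E "d k" C b
  proof
    show "(\<integral>\<eta>. d k (\<eta> x) * d k (\<eta> y) \<partial>\<mu>) = b" if "x \<noteq> y" for x y
    proof -
      have "(\<integral>\<eta>. d k (\<eta> x) * d k (\<eta> y) \<partial>\<mu>) = (\<integral>\<eta>. D (((\<lambda>_. 0)(x := k))(y := k)) \<eta> \<partial>\<mu>)"
        by (intro Bochner_Integration.integral_cong) (simp_all add: D_pair[OF _ k that])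
      then show ?thesis using b pair_config[OF k] particles_pair[OF k that] by simp
    qed
  qed (fact d_measurable[OF k] C)+
  show ?thesis by (rule expectation_mult_obs[OF W F w])
qed

lemma expectation_D_fun_upd:
  assumes \<xi>: "\<xi> \<in> configurations" and k: "k \<in> K" and y: "\<xi> y = 0"
  shows "(\<integral>\<eta>. D (\<xi>(y := k)) \<eta> \<partial>\<mu>) = expectation (D \<xi>) * (\<integral>\<eta>. d k (\<eta> 0) \<partial>\<mu>)"
proof -
  have fin: "finite {x. \<xi> x \<noteq> 0}" using \<xi> by (simp add: finite_configs_iff)
  obtain c where c: "\<forall>\<zeta>\<in>configurations. particles \<zeta> = particles \<xi> + k \<longrightarrow> (\<integral>\<eta>. D \<zeta> \<eta> \<partial>\<mu>) = c"
    using expectation_const[of "particles \<xi> + k"] by auto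
  have eq_c: "(\<integral>\<eta>. D (\<xi>(x := k)) \<eta> \<partial>\<mu>) = c" if x: "\<xi> x = 0" for x
    using c fun_upd_config[OF \<xi> k] particles_fun_upd[OF \<xi> fun_upd_config[OF \<xi> k] x] by blast
  have "(\<integral>\<eta>. D \<xi> \<eta> * d k (\<eta> x) \<partial>\<mu>) = c" if "x \<notin> {x. \<xi> x \<noteq> 0}" for x
  proof -
    have x: "\<xi> x = 0" using that by blast
    have "(\<integral>\<eta>. D \<xi> \<eta> * d k (\<eta> x) \<partial>\<mu>) = (\<integral>\<eta>. D (\<xi>(x := k)) \<eta> \<partial>\<mu>)"
      by (rule Bochner_Integration.integral_cong[OF refl], rule D_fun_upd[OF _ \<xi> x, symmetric])
    then show ?thesis by (simp only: eq_c[OF x])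
  qed
  from expectation_mult_site[OF k integrable_D[OF \<xi>] fin this] eq_c[OF y]
  show ?thesis by metis
qed

lemma expectation_D_zero: "expectation (D (\<lambda>_. 0)) = 1"
proof -
  have "expectation (D (\<lambda>_. 0)) = (\<integral>\<eta>. 1 \<partial>\<mu>)"
    by (intro Bochner_Integration.integral_cong) (simp_all add: D_zero)
  then show ?thesis by (simp add: prob_space)
qed

lemma expectation_D_single:
  assumes "1 \<in> K"
  shows "expectation (D (single x)) = (\<integral>\<eta>. d 1 (\<eta> 0) \<partial>\<mu>)"
proof -
  have "single x = (\<lambda>_. 0)(x := 1)" by (auto simp: single_def)
  then show ?thesis
    using expectation_D_fun_upd[OF zero_config assms, of x] by (simp add: expectation_D_zero)
qed

text \<open>Compare \<open>\<xi>\<close> with a configuration of equally many particles, all on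
  distinct sites: its expectation is visibly a power, and equal particle numbers give equal
  expectations.\<close>

lemma expectation_D_eq_power:
  assumes \<xi>: "\<xi> \<in> configurations"
  shows "expectation (D \<xi>) = expectation (D (single x)) ^ particles \<xi>"
proof (cases "1 \<in> K")
  case True
  have "\<exists>\<zeta>\<in>configurations. particles \<zeta> = n \<and> expectation (D \<zeta>) = expectation (D (single x)) ^ n" for n
  proof (induction n)
    case 0
    then show ?case by (intro bexI[of _ "\<lambda>_. 0"]) (simp_all add: particles_zero expectation_D_zero)
  next
    case (Suc n)
    then obtain \<zeta> where \<zeta>: "\<zeta> \<in> configurations" "particles \<zeta> = n"
      "expectation (D \<zeta>) = expectation (D (single x)) ^ n" by blast
    have "finite {y. \<zeta> y \<noteq> 0}" using \<zeta>(1) by (simp add: finite_configs_iff)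
    then obtain y where y: "\<zeta> y = 0" using ex_new_if_finite[OF infinite_sites] by blast
    show ?case
    proof (intro bexI[of _ "\<zeta>(y := 1)"] conjI)
      show "particles (\<zeta>(y := 1)) = Suc n"
        using particles_fun_upd[OF \<zeta>(1) fun_upd_config[OF \<zeta>(1) True] y] \<zeta>(2) by simp
      show "expectation (D (\<zeta>(y := 1))) = expectation (D (single x)) ^ Suc n"
        using expectation_D_fun_upd[OF \<zeta>(1) True y] \<zeta>(3) expectation_D_single[OF True, of x] by simp
    qed (rule fun_upd_config[OF \<zeta>(1) True])
  qed
  then obtain \<zeta> where \<zeta>: "\<zeta> \<in> configurations" "particles \<zeta> = particles \<xi>"
    "expectation (D \<zeta>) = expectation (D (single x)) ^ particles \<xi>" by blast
  obtain c where "\<forall>\<zeta>\<in>configurations. particles \<zeta> = particles \<xi> \<longrightarrow> (\<integral>\<eta>. D \<zeta> \<eta> \<partial>\<mu>) = c"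
    using expectation_const by blast
  then have "expectation (D \<xi>) = expectation (D \<zeta>)" using \<xi> \<zeta> by simp
  then show ?thesis using \<zeta>(3) by simp
next
  case False
  \<comment> \<open>Here \<open>single x\<close> is not a dual configuration, but only the empty
    configuration is left and the exponent is 0.\<close>
  then have "K = {0}"
    using K unfolding dual_site_space_def by (metis UNIV_I atLeastAtMost_iff atLeastAtMost_singleton le0 less_one not_le)
  then have "\<xi> = (\<lambda>_. 0)" using \<xi> by (auto simp: finite_configs_iff)
  then show ?thesis by (simp add: particles_zero expectation_D_zero)
qed

section \<open>Independence of the coordinates\<close>

text \<open>Finitely many sites carry factors other than 1, and each factor is almost surely
  bounded. This makes \<open>D \<xi>\<close> usable as the basis of a density.\<close>

lemma AE_D_bound:
  assumes \<xi>: "\<xi> \<in> configurations"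
  shows "\<exists>C. AE \<eta> in \<mu>. \<bar>D \<xi> \<eta>\<bar> \<le> C"
proof -
  let ?S = "{x. \<xi> x \<noteq> 0}"
  have S: "finite ?S" and K': "\<xi> x \<in> K" for x using \<xi> by (auto simp: finite_configs_iff)
  have "\<exists>C. AE \<eta> in \<mu>. \<bar>d (\<xi> x) (\<eta> x)\<bar> \<le> C" for x
  proof -
    obtain C where "AE \<eta> in \<mu>. \<forall>y. \<bar>d (\<xi> x) (\<eta> y)\<bar> \<le> C" using AE_site_bound[OF K'] by blast
    then have "AE \<eta> in \<mu>. \<bar>d (\<xi> x) (\<eta> x)\<bar> \<le> C" by eventually_elim blast
    then show ?thesis ..
  qed
  then obtain C where "AE \<eta> in \<mu>. \<bar>d (\<xi> x) (\<eta> x)\<bar> \<le> C x" for x by metis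
  then have "AE \<eta> in \<mu>. \<forall>x. \<bar>d (\<xi> x) (\<eta> x)\<bar> \<le> C x" by (simp add: AE_all_countable)
  then have "AE \<eta> in \<mu>. \<bar>D \<xi> \<eta>\<bar> \<le> (\<Prod>x\<in>?S. C x)"
    using AE_space
  proof eventually_elim
    case (elim \<eta>)
    then have "\<bar>D \<xi> \<eta>\<bar> = (\<Prod>x\<in>?S. \<bar>d (\<xi> x) (\<eta> x)\<bar>)"
      by (subst D_eq_prod[OF _ S]) (auto simp: abs_prod)
    also have "\<dots> \<le> (\<Prod>x\<in>?S. C x)" using elim by (intro prod_mono) auto
    finally show ?case .
  qed
  then show ?thesis by blast
qed

lemma sets_marginal [measurable_cong]: "sets (marginal E \<mu> x) = sets (site_measurable E)"
  by (simp add: marginal_def)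

lemma prob_space_marginal: "prob_space (marginal E \<mu> x)"
  unfolding marginal_def by (rule prob_space_distr) measurable

lemma integral_marginal:
  fixes f :: "real \<Rightarrow> real"
  assumes "f \<in> borel_measurable (site_measurable E)"
  shows "(\<integral>e. f e \<partial>marginal E \<mu> x) = (\<integral>\<eta>. f (\<eta> x) \<partial>\<mu>)"
  unfolding marginal_def using assms by (subst integral_distr) auto

lemma integral_site: "k \<in> K \<Longrightarrow> (\<integral>\<eta>. d k (\<eta> x) \<partial>\<mu>) = (\<integral>\<eta>. d k (\<eta> 0) \<partial>\<mu>)"
  using integral_shift[of "\<lambda>\<eta>. d k (\<eta> 0)" x] measurable_compose[OF measurable_site d_measurable]
  by (simp add: shift_def)

text \<open>Weighting \<open>\<mu>\<close> by the positive density proportional to \<open>W + C + 1\<close> does not change the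
  integrals of the \<open>d k\<close> at \<open>y\<close>, hence, by determinacy, not the marginal at \<open>y\<close> either.\<close>

lemma expectation_mult_indicator:
  assumes W [measurable]: "W \<in> borel_measurable \<mu>" and W_bound: "AE \<eta> in \<mu>. \<bar>W \<eta>\<bar> \<le> C"
    and det: "determined_by E K d (marginal E \<mu> y)"
    and uncorr: "\<And>k. k \<in> K \<Longrightarrow>
      (\<integral>\<eta>. W \<eta> * d k (\<eta> y) \<partial>\<mu>) = expectation W * (\<integral>\<eta>. d k (\<eta> y) \<partial>\<mu>)"
    and B [measurable]: "B \<in> sets (site_measurable E)"
  shows "(\<integral>\<eta>. W \<eta> * indicator B (\<eta> y) \<partial>\<mu>) = expectation W * measure (marginal E \<mu> y) B"
proof -
  have W_int: "integrable \<mu> W" by (rule integrable_const_bound[where B = C]) (use W_bound in auto)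
  \<comment> \<open>Adding C makes the weight nonnegative; the further 1 keeps its mean
    \<open>N\<close> away from 0, so that it can be normalized.\<close>
  define U where "U \<eta> = W \<eta> + C + 1" for \<eta>
  have [measurable]: "U \<in> borel_measurable \<mu>" unfolding U_def by measurable
  have U_ge: "AE \<eta> in \<mu>. 1 \<le> U \<eta>" using W_bound by eventually_elim (auto simp: U_def)
  have U_int: "integrable \<mu> U" unfolding U_def using W_int by simp
  define N where "N = expectation U"
  have N_eq: "N = expectation W + C + 1" unfolding N_def U_def using W_int by (simp add: prob_space)
  have "1 \<le> N" unfolding N_def using U_int U_ge integral_ge_const by blast
  then have N: "0 < N" by simp
  define M' where "M' = density \<mu> (\<lambda>\<eta>. ennreal (U \<eta> / N))"
  have nn: "AE \<eta> in \<mu>. 0 \<le> U \<eta> / N" using U_ge by eventually_elim (use N in auto)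
  have [measurable_cong]: "sets M' = sets \<mu>" by (simp add: M'_def)
  have "prob_space M'"
  proof
    have "emeasure M' (space M') = (\<integral>\<^sup>+\<eta>. ennreal (U \<eta> / N) \<partial>\<mu>)"
      by (simp add: M'_def emeasure_density cong: nn_integral_cong)
    also have "\<dots> = ennreal (\<integral>\<eta>. U \<eta> / N \<partial>\<mu>)"
      using U_int nn by (intro nn_integral_eq_integral) auto
    finally show "emeasure M' (space M') = 1" using N by (simp add: N_def)
  qed
  define \<nu>' where "\<nu>' = distr M' (site_measurable E) (\<lambda>\<eta>. \<eta> y)"
  interpret \<nu>': prob_space \<nu>'
    unfolding \<nu>'_def by (rule prob_space.prob_space_distr[OF \<open>prob_space M'\<close>]) measurable
  \<comment> \<open>Applied twice: to \<open>d k\<close>, where the uncorrelatedness collapses the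
    right-hand side to the integral under the marginal, and to \<open>indicator B\<close>.\<close>
  have integral_\<nu>': "(\<integral>e. f e \<partial>\<nu>') = ((\<integral>\<eta>. W \<eta> * f (\<eta> y) \<partial>\<mu>) + (C + 1) * (\<integral>\<eta>. f (\<eta> y) \<partial>\<mu>)) / N"
      and integrable_\<nu>': "integrable \<nu>' f"
    if f [measurable]: "f \<in> borel_measurable (site_measurable E)"
      and f_bound: "AE \<eta> in \<mu>. \<bar>f (\<eta> y)\<bar> \<le> b" for f :: "real \<Rightarrow> real" and b
  proof -
    have int1: "integrable \<mu> (\<lambda>\<eta>. f (\<eta> y))"
      by (rule integrable_const_bound[where B = b]) (use f_bound in auto)
    have int2: "integrable \<mu> (\<lambda>\<eta>. W \<eta> * f (\<eta> y))"
    proof (rule integrable_const_bound[where B = "C * b"])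
      show "AE \<eta> in \<mu>. norm (W \<eta> * f (\<eta> y)) \<le> C * b"
        using W_bound f_bound by eventually_elim (auto simp: abs_mult intro!: mult_mono)
    qed measurable
    have eq: "U \<eta> / N * f (\<eta> y) = (W \<eta> * f (\<eta> y) + (C + 1) * f (\<eta> y)) / N" for \<eta>
      by (simp add: U_def algebra_simps add_divide_distrib)
    have "(\<integral>e. f e \<partial>\<nu>') = (\<integral>\<eta>. U \<eta> / N * f (\<eta> y) \<partial>\<mu>)"
      unfolding \<nu>'_def M'_def using nn by (subst integral_distr) (simp_all add: integral_density)
    then show "(\<integral>e. f e \<partial>\<nu>') = ((\<integral>\<eta>. W \<eta> * f (\<eta> y) \<partial>\<mu>) + (C + 1) * (\<integral>\<eta>. f (\<eta> y) \<partial>\<mu>)) / N"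
      using int1 int2 by (simp only: eq) simp
    have "integrable \<mu> (\<lambda>\<eta>. U \<eta> / N * f (\<eta> y))"
      using int1 int2 by (simp only: eq) simp
    then show "integrable \<nu>' f"
      unfolding \<nu>'_def M'_def using nn by (subst integrable_distr_eq) (simp_all add: integrable_density)
  qed
  have "\<nu>' = marginal E \<mu> y"
  proof -
    have "integrable \<nu>' (d k) \<and> (\<integral>e. d k e \<partial>\<nu>') = (\<integral>e. d k e \<partial>marginal E \<mu> y)" if k: "k \<in> K" for k
    proof -
      obtain b where "AE \<eta> in \<mu>. \<forall>x. \<bar>d k (\<eta> x)\<bar> \<le> b" using AE_site_bound[OF k] by blast
      then have b: "AE \<eta> in \<mu>. \<bar>d k (\<eta> y)\<bar> \<le> b" by eventually_elim blast
      have "(\<integral>e. d k e \<partial>\<nu>') = (N * (\<integral>\<eta>. d k (\<eta> y) \<partial>\<mu>)) / N"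
        unfolding integral_\<nu>'[OF d_measurable[OF k] b] uncorr[OF k] N_eq by (simp add: algebra_simps)
      then show ?thesis
        using integrable_\<nu>'[OF d_measurable[OF k] b] N by (simp add: integral_marginal[OF d_measurable[OF k]])
    qed
    moreover have "sets \<nu>' = sets (site_measurable E)" by (simp add: \<nu>'_def)
    ultimately show ?thesis using det \<nu>'.prob_space_axioms unfolding determined_by_def by blast
  qed
  \<comment> \<open>With p the marginal probability of B and I the integral sought, this reads p =
    (I + (C + 1) p) / N, so I = (N - C - 1) p, and N - C - 1 is the mean of W.\<close>
  moreover have "(\<integral>e. indicator B e \<partial>\<nu>') =
      ((\<integral>\<eta>. W \<eta> * indicator B (\<eta> y) \<partial>\<mu>) + (C + 1) * (\<integral>\<eta>. indicator B (\<eta> y) \<partial>\<mu>)) / N"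
    by (rule integral_\<nu>'(1)[of _ 1]) (auto split: split_indicator)
  moreover have p: "(\<integral>\<eta>. indicator B (\<eta> y) \<partial>\<mu>) = measure (marginal E \<mu> y) B"
    using integral_marginal[of "indicator B" y] by (simp add: sets_marginal)
  moreover have "(\<integral>e. indicator B e \<partial>marginal E \<mu> y) = measure (marginal E \<mu> y) B"
    by (simp add: sets_marginal)
  ultimately show ?thesis using N by (simp add: field_simps N_eq)
qed

text \<open>The factors \<open>d (\<xi> x) (\<eta> x)\<close> are replaced by indicators one site at a time.\<close>

lemma expectation_indicators_mult_D:
  assumes det: "\<And>x. determined_by E K d (marginal E \<mu> x)"
    and "finite I" and "\<xi> \<in> configurations" and "\<And>x. x \<in> I \<Longrightarrow> \<xi> x = 0"
    and "\<And>x. x \<in> I \<Longrightarrow> A x \<in> sets (site_measurable E)"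
  shows "(\<integral>\<eta>. (\<Prod>x\<in>I. indicator (A x) (\<eta> x)) * D \<xi> \<eta> \<partial>\<mu>) =
    (\<Prod>x\<in>I. measure (marginal E \<mu> x) (A x)) * expectation (D \<xi>)"
  using assms(2-)
\<comment> \<open>The hypothesis is needed for two configurations: \<open>\<xi>\<close> gives the
  mean of the weight, and \<open>\<xi>(y := k)\<close> its integral against \<open>d k\<close> at
  the new site.\<close>
proof (induction I arbitrary: \<xi>)
  case (insert y I)
  note A = insert.prems(3) and \<xi> = insert.prems(1)
  have [measurable]: "A x \<in> sets (site_measurable E)" if "x \<in> I" for x using A that by simp
  note D_measurable[OF \<xi>, measurable]
  have y: "\<xi> y = 0" using insert.prems(2) by simp
  define W where "W \<eta> = (\<Prod>x\<in>I. indicator (A x) (\<eta> x)) * D \<xi> \<eta>" for \<eta>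
  have EW: "expectation W = (\<Prod>x\<in>I. measure (marginal E \<mu> x) (A x)) * expectation (D \<xi>)"
    unfolding W_def by (rule insert.IH) (use insert.prems in auto)
  have [measurable]: "W \<in> borel_measurable \<mu>" unfolding W_def by measurable
  obtain C where C: "AE \<eta> in \<mu>. \<bar>D \<xi> \<eta>\<bar> \<le> C" using AE_D_bound[OF \<xi>] by blast
  have ind: "\<bar>\<Prod>x\<in>I. indicator (A x) (\<eta> x) :: real\<bar> \<le> 1" for \<eta> :: "'a \<Rightarrow> real"
    unfolding abs_prod by (intro prod_le_1) (auto split: split_indicator)
  have W_bound: "AE \<eta> in \<mu>. \<bar>W \<eta>\<bar> \<le> C"
    using C
  proof eventually_elim
    case (elim \<eta>)
    then show ?case
      using mult_mono[OF ind[of \<eta>] elim] by (simp add: W_def abs_mult)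
  qed
  have "(\<integral>\<eta>. W \<eta> * indicator (A y) (\<eta> y) \<partial>\<mu>) = expectation W * measure (marginal E \<mu> y) (A y)"
  proof (rule expectation_mult_indicator[OF _ W_bound det])
    fix k assume k: "k \<in> K"
    have "(\<integral>\<eta>. W \<eta> * d k (\<eta> y) \<partial>\<mu>) = (\<integral>\<eta>. (\<Prod>x\<in>I. indicator (A x) (\<eta> x)) * D (\<xi>(y := k)) \<eta> \<partial>\<mu>)"
      by (intro Bochner_Integration.integral_cong) (simp_all add: W_def D_fun_upd[OF _ \<xi> y])
    also have "\<dots> = (\<Prod>x\<in>I. measure (marginal E \<mu> x) (A x)) * expectation (D (\<xi>(y := k)))"
    proof (rule insert.IH[OF fun_upd_config[OF \<xi> k]])
      show "(\<xi>(y := k)) x = 0" if "x \<in> I" for x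
        using that insert.hyps(2) insert.prems(2)[of x] by auto
    qed (use A in simp)
    also have "\<dots> = expectation W * (\<integral>\<eta>. d k (\<eta> y) \<partial>\<mu>)"
      unfolding EW expectation_D_fun_upd[OF \<xi> k y] integral_site[OF k, of y] by simp
    finally show "(\<integral>\<eta>. W \<eta> * d k (\<eta> y) \<partial>\<mu>) = expectation W * (\<integral>\<eta>. d k (\<eta> y) \<partial>\<mu>)" .
  qed (use A in auto)
  then have "(\<integral>\<eta>. W \<eta> * indicator (A y) (\<eta> y) \<partial>\<mu>) =
      (\<Prod>x\<in>insert y I. measure (marginal E \<mu> x) (A x)) * expectation (D \<xi>)"
    using insert.hyps by (simp add: EW)
  then show ?case
    using insert.hyps by (simp add: W_def mult_ac)
qed simp

text \<open>For the empty configuration \<open>D\<close> is 1, so the indicator formula gives the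
  probabilities of finite-dimensional rectangles, which determine the measure.\<close>

lemma product_measure_of_determined:
  assumes det: "\<And>x. determined_by E K d (marginal E \<mu> x)"
  shows "product_measure E \<mu>"
proof -
  let ?\<nu> = "marginal E \<mu>"
  interpret marginal: prob_space "?\<nu> x" for x by (rule prob_space_marginal)
  interpret \<nu>: product_prob_space ?\<nu> UNIV ..
  have "\<mu> = PiM UNIV ?\<nu>"
  proof (rule \<nu>.PiM_eq)
    show "sets \<mu> = sets (PiM UNIV ?\<nu>)"
      unfolding sets_eq configs_def by (intro sets_PiM_cong) (simp_all add: sets_marginal)
    fix J :: "'a set" and A
    assume J: "finite J" and "\<And>x. x \<in> J \<Longrightarrow> A x \<in> sets (?\<nu> x)"
    then have A [measurable]: "\<And>x. x \<in> J \<Longrightarrow> A x \<in> sets (site_measurable E)"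
      by (simp add: sets_marginal)
    have emb: "prod_emb UNIV ?\<nu> J (\<Pi>\<^sub>E x\<in>J. A x) = {\<eta>\<in>space \<mu>. \<forall>x\<in>J. \<eta> x \<in> A x}"
    proof -
      have "space (?\<nu> x) = E" for x
        by (simp add: marginal_def site_measurable_def space_restrict_space)
      then show ?thesis by (auto simp: prod_emb_iff space_eq restrict_PiE_iff)
    qed
    have "prob {\<eta>\<in>space \<mu>. \<forall>x\<in>J. \<eta> x \<in> A x} =
        (\<integral>\<eta>. indicator {\<eta>\<in>space \<mu>. \<forall>x\<in>J. \<eta> x \<in> A x} \<eta> \<partial>\<mu>)"
      using J by simp
    also have "\<dots> = (\<integral>\<eta>. (\<Prod>x\<in>J. indicator (A x) (\<eta> x)) * D (\<lambda>_. 0) \<eta> \<partial>\<mu>)"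
      using J by (intro Bochner_Integration.integral_cong)
        (auto simp: D_zero prod_eq_1_iff prod_zero_iff split: split_indicator)
    also have "\<dots> = (\<Prod>x\<in>J. measure (?\<nu> x) (A x))"
      using expectation_indicators_mult_D[OF det J zero_config, of A] A by (simp add: expectation_D_zero)
    finally show "emeasure \<mu> (prod_emb UNIV ?\<nu> J (\<Pi>\<^sub>E x\<in>J. A x)) = (\<Prod>x\<in>J. emeasure (?\<nu> x) (A x))"
      unfolding emb by (simp add: emeasure_eq_measure marginal.emeasure_eq_measure prod_ennreal)
  qed
  then show ?thesis
    unfolding product_measure_def
    by (intro exI[of _ ?\<nu>]) (simp add: prob_space_marginal sets_marginal)
qed

end

section \<open>Application to the integer lattice\<close>

lemma infinite_UNIV_int_vec: "infinite (UNIV :: (int ^ 'd) set)"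
proof
  assume fin: "finite (UNIV :: (int ^ 'd) set)"
  have "inj (\<lambda>i. (\<chi> _. i) :: int ^ 'd)" by (auto simp: inj_on_def vec_eq_iff)
  from finite_imageD[OF finite_subset[OF subset_UNIV fin] this] show False
    by (simp add: infinite_UNIV_int)
qed

theorem theorem3p3:
  fixes E :: "real set" and K :: "nat set"
    and P :: "real \<Rightarrow> (int ^ 'd \<Rightarrow> real) \<Rightarrow> (int ^ 'd \<Rightarrow> real) measure"
    and Q :: "real \<Rightarrow> (int ^ 'd \<Rightarrow> nat) \<Rightarrow> (int ^ 'd \<Rightarrow> nat) measure"
    and d :: "nat \<Rightarrow> real \<Rightarrow> real"
    and \<mu> :: "(int ^ 'd \<Rightarrow> real) measure"
  assumes "process_site_space E" and "dual_site_space K"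
    and "markov_semigroup (configs E) P"
    and "markov_semigroup (count_space (finite_configs K)) Q"
    and "\<And>e. e \<in> E \<Longrightarrow> d 0 e = 1"
    and "dual_processes E K P Q (factorized d)"
    and "conserves_particles K Q"
    and "bounded_harmonic_triviality K Q"
    and "prob_space \<mu>" and "sets \<mu> = sets (configs E)"
    and "uniform_domination E K (factorized d) \<mu>"
    and "translation_invariant \<mu>" and "translation_ergodic \<mu>"
    and "stationary P \<mu>"
  shows "(\<forall>\<xi>\<in>finite_configs K. \<forall>x.
            (\<integral>\<eta>. factorized d \<xi> \<eta> \<partial>\<mu>) = (\<integral>\<eta>. factorized d (single x) \<eta> \<partial>\<mu>) ^ particles \<xi>) \<and>
         ((\<forall>x. determined_by E K d (marginal E \<mu> x)) \<longrightarrow> product_measure E \<mu>)"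
proof -
  interpret prob_space \<mu> by fact
  interpret duality_field \<mu> E K d
  proof
    show "factorized d \<xi> \<in> borel_measurable (configs E)"
      if "\<xi> \<in> finite_configs K" for \<xi> :: "int ^ 'd \<Rightarrow> nat"
      using assms(6) that by (simp add: dual_processes_def)
    show "\<exists>c. \<forall>\<xi>\<in>finite_configs K. particles \<xi> = n \<longrightarrow> (\<integral>\<eta>. factorized d \<xi> \<eta> \<partial>\<mu>) = c" for n
      by (rule dual_expectation_const) (fact assms)+
  qed (fact assms infinite_UNIV_int_vec)+
  show ?thesis
    by (intro conjI ballI allI impI expectation_D_eq_power product_measure_of_determined) simp_all
qed

end
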